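(* Let $n,m\ge 2$ be two different integers. Then $V_n(P)$ and $V_m(Q)$ are not isomorphic (as groups) for any $P\le \mathrm{Sym}(n)$ and $Q\le\mathrm{Sym}(m)$.
   Context: For $n\ge2$ let $C_n=\{1,\dots,n\}^{\mathbb N}$. For $\sigma\in \mathrm{Sym}(n)$ and $w=w_1w_2\cdots\in C_n$ put $\sigma(w)=\sigma(w_1)\sigma(w_2)\cdots$. For a finite (possibly empty) word $u$ in $\{1,\dots,n\}$, the branch $B_u$ is $\{uw: w\in\{1,\dots,n\}^{\mathbb N}\}$. Branches $B_u,B_{u'}$ are independent if neither of $u,u'$ is a proper prefix of the other; a set of branches is complete if its union is $C_n$. For $H\le\mathrm{Sym}(n)$, $V_n(H)$ is the group (under composition) of all bijections $g:C_n\to C_n$ for which there is a finite complete set $\mathcal B$ of pairwise independent branches such that for every $B=B_u\in\mathcal B$ the set $g(B)=B_{u'}$ is a branch and there is $\sigma\in H$ with $g(uw)=u'\sigma(w)$ for all $w\in\{1,\dots,n\}^{\mathbb N}$. *)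

theory Defs
  imports "HOL-Algebra.Algebra" "HOL-Library.Stream" "HOL-Library.Sublist"
begin

(* The space C_n is the library's "streams {1..n}", the concatenation u w is "u @- w", and
   sigma acts letterwise on infinite words by "smap". *)
abbreviation cantor :: "nat \<Rightarrow> nat stream set" where
  "cantor n \<equiv> streams {1..n}"

definition branch :: "nat \<Rightarrow> nat list \<Rightarrow> nat stream set" where
  "branch n u = {u @- w | w. w \<in> cantor n}"

definition branches :: "nat \<Rightarrow> nat stream set set" where
  "branches n = {branch n u | u. u \<in> lists {1..n}}"

(* For n \<ge> 2 a branch determines its word, so the choice of u and u' is immaterial. *)
definition independent_branches :: "nat \<Rightarrow> nat stream set \<Rightarrow> nat stream set \<Rightarrow> bool" where
  "independent_branches n B B' \<longleftrightarrow>
     (\<exists>u\<in>lists {1..n}. \<exists>u'\<in>lists {1..n}. B = branch n u \<and> B' = branch n u' \<and>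
        \<not> strict_prefix u u' \<and> \<not> strict_prefix u' u)"

definition complete_branches :: "nat \<Rightarrow> nat stream set set \<Rightarrow> bool" where
  "complete_branches n \<B> \<longleftrightarrow> \<B> \<subseteq> branches n \<and> \<Union>\<B> = cantor n"

(* Elements of "Bij S" are bijections of S made "undefined" outside S, so that equality of group
   elements is equality of maps on C_n; "BijGroup S" is Bij S under composition. *)
definition V_set :: "nat \<Rightarrow> (nat \<Rightarrow> nat) set \<Rightarrow> (nat stream \<Rightarrow> nat stream) set" where
  "V_set n H =
     {g \<in> Bij (cantor n).
        \<exists>\<B>. finite \<B> \<and> complete_branches n \<B> \<and> pairwise (independent_branches n) \<B> \<and>
          (\<forall>u\<in>lists {1..n}. branch n u \<in> \<B> \<longrightarrow>
             (\<exists>u'\<in>lists {1..n}. g ` branch n u = branch n u' \<and>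
                (\<exists>\<sigma>\<in>H. \<forall>w\<in>cantor n. g (u @- w) = u' @- smap \<sigma> w)))}"

definition V :: "nat \<Rightarrow> (nat \<Rightarrow> nat) set \<Rightarrow> (nat stream \<Rightarrow> nat stream) monoid" where
  "V n H = (BijGroup (cantor n))\<lparr>carrier := V_set n H\<rparr>"

end

theory Submission
  imports Defs "HOL-Number_Theory.Cong"
begin

text \<open>
  The number of letters can be read off the group: for a prime \<open>p > n\<close>, the group \<open>V n H\<close> has exactly
  \<open>n\<close> conjugacy classes of elements of order \<open>p\<close>, whatever the label group \<open>H\<close> is. An isomorphism
  preserves this number, so comparing it for a prime above both alphabet sizes separates
  the two groups.

  To count the classes, take an element \<open>g\<close> of order \<open>p\<close>. It permutes the branches of some finite
  partition of the Cantor space (\<open>invariant_code\<close>), in orbits of length 1 and \<open>p\<close>. On a branch that is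
  mapped to itself, \<open>g\<close> acts by a label of order dividing \<open>p\<close>; a permutation of \<open>n < p\<close> letters with
  this property is trivial, so \<open>g\<close> fixes the branch pointwise. Hence the space is a disjoint union of a
  fixed clopen part \<open>E\<close> and the \<open>p\<close> translates of a clopen fundamental domain \<open>D\<close>
  (\<open>torsion_structure\<close>), and labels no longer matter: any two elements whose parts \<open>E\<close> and \<open>D\<close> are
  equivalent under tame bijections are conjugate (\<open>conjugate_if_fundamental\<close>).

  Splitting a branch into its \<open>n\<close> children changes the number of branches by \<open>n - 1\<close>. Consequently the
  number of branches in a partition of a clopen set is well defined modulo \<open>n - 1\<close>
  (\<open>card_cong_if_region_eq\<close>), is invariant under the group (\<open>tame_image_card\<close>), and classifies nonempty
  clopen sets (\<open>regions_equivalent\<close>). The whole space has size 1, so the sizes satisfy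
  \<open>|E| + p |D| \<equiv> 1\<close>. If \<open>E\<close> is nonempty, the class of \<open>g\<close> is given by \<open>|D|\<close>, and each of the \<open>n - 1\<close>
  residues occurs. If \<open>E\<close> is empty, then \<open>p |D| \<equiv> 1\<close> leaves one residue, as \<open>p\<close> is coprime to \<open>n - 1\<close>,
  and this class occurs too. Together these are \<open>n\<close> classes (\<open>nonconjugate_family_card_le\<close>,
  \<open>nonconjugate_family_exists\<close>).

  The technical device is to describe elements of the group by a condition at each point (\<open>tame\<close>) instead
  of a finite partition; compactness makes the two agree (\<open>V_set_iff\<close>).
\<close>

section \<open>Branches\<close>

text \<open>Membership in \<open>lists {1..n}\<close> and the numeral 1 serve below as atoms; unfolding them letter by
  letter or to \<open>Suc 0\<close> would hide the assumptions of the rules about words.\<close>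

declare in_listsD [rule del] in_listsI [rule del] One_nat_def [simp del]

lemma branch_eq_image: "branch n u = (@-) u ` cantor n"
  by (auto simp: branch_def)

lemma in_branch_iff:
  assumes "u \<in> lists {1..n}"
  shows "x \<in> branch n u \<longleftrightarrow> x \<in> cantor n \<and> stake (length u) x = u"
proof
  assume "x \<in> branch n u"
  then show "x \<in> cantor n \<and> stake (length u) x = u"
    using assms by (auto simp: branch_def shift_streams stake_shift)
next
  assume "x \<in> cantor n \<and> stake (length u) x = u"
  then have "x = u @- sdrop (length u) x" "sdrop (length u) x \<in> cantor n"
    by (metis stake_sdrop, auto simp: streams_iff_snth sdrop_snth)
  then show "x \<in> branch n u"
    by (auto simp: branch_def)
qed

lemma stake_in_lists: "x \<in> cantor n \<Longrightarrow> stake d x \<in> lists {1..n}"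
  by (induction d arbitrary: x) (auto elim: streamsE)

lemma sdrop_in_cantor: "x \<in> cantor n \<Longrightarrow> sdrop d x \<in> cantor n"
  by (auto simp: streams_iff_snth sdrop_snth)

lemma in_branch_stake: "x \<in> cantor n \<Longrightarrow> x \<in> branch n (stake d x)"
  by (simp add: in_branch_iff[OF stake_in_lists])

lemma shift_in_branch: "w \<in> cantor n \<Longrightarrow> u @- w \<in> branch n u"
  by (auto simp: branch_def)

lemma branch_subset_cantor: "u \<in> lists {1..n} \<Longrightarrow> branch n u \<subseteq> cantor n"
  by (auto simp: in_branch_iff)

lemma branch_append_subset:
  assumes "v \<in> lists {1..n}"
  shows "branch n (u @ v) \<subseteq> branch n u"
  using assms by (auto simp: branch_def shift_streams)

lemma branch_Nil [simp]: "branch n [] = cantor n"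
  by (auto simp: branch_def)

lemma cantor_nonempty:
  assumes "1 \<le> n"
  obtains w where "w \<in> cantor n"
proof
  show "cycle [1] \<in> cantor n"
    using assms by (auto simp: streams_iff_sset sset_cycle)
qed

lemma branch_nonempty: "1 \<le> n \<Longrightarrow> branch n u \<noteq> {}"
  by (metis cantor_nonempty shift_in_branch empty_iff)

lemma nested_words:
  assumes "x \<in> branch n u" "x \<in> branch n v" "length u \<le> length v"
    "u \<in> lists {1..n}" "v \<in> lists {1..n}"
  obtains v' where "v' \<in> lists {1..n}" "v = u @ v'"
proof
  have "u = take (length u) v"
    using assms by (metis in_branch_iff take_stake min.absorb1)
  then show "v = u @ drop (length u) v"
    by (metis append_take_drop_id)
  then show "drop (length u) v \<in> lists {1..n}"
    using assms(5) by (metis append_in_lists_conv)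
qed

text \<open>This fails for a one-letter alphabet, where all branches coincide.\<close>

lemma branch_subset_imp_length_le:
  assumes n: "2 \<le> n" and uv: "u \<in> lists {1..n}" "v \<in> lists {1..n}"
    and sub: "branch n u \<subseteq> branch n v"
  shows "length v \<le> length u"
proof (rule ccontr)
  assume less: "\<not> length v \<le> length u"
  obtain x where x: "x \<in> branch n u"
    using branch_nonempty[of n u] n by auto
  then have "x \<in> branch n v" using sub by blast
  then obtain v' where v': "v' \<in> lists {1..n}" "v = u @ v'"
    using nested_words[OF x _ _ uv] less by auto
  then have ne: "v' \<noteq> []" using less by auto
  \<comment> \<open>Two words of length one cannot both continue u inside the branch of v.\<close>
  define a where "a = (if hd v' = 1 then 2 else 1 :: nat)"
  obtain w where w: "w \<in> cantor n" using cantor_nonempty[of n] n by auto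
  have "a ## w \<in> cantor n" using n w by (auto simp: a_def)
  then have "u @- (a ## w) \<in> branch n v"
    using sub shift_in_branch by blast
  then obtain z where "u @- (a ## w) = u @- (v' @- z)"
    by (auto simp: branch_def v')
  then have "a ## w = v' @- z" by simp
  then have "a = hd v'" using ne by (metis shift_simps(1) stream.sel(1))
  then show False by (auto simp: a_def split: if_splits)
qed

lemma branch_inject:
  assumes "2 \<le> n" "u \<in> lists {1..n}" "v \<in> lists {1..n}" "branch n u = branch n v"
  shows "u = v"
proof -
  have len: "length u = length v"
    using branch_subset_imp_length_le[of n] assms by (metis order.refl le_antisym)
  obtain x where "x \<in> branch n u"
    using branch_nonempty[of n u] assms(1) by auto
  then show ?thesis using assms(2-4) len by (metis in_branch_iff)
qed

section \<open>Maps that are rigid near a point\<close>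

text \<open>The condition that the definition of \<open>V_set\<close> imposes on the branch of one word \<open>u\<close> of the complete set.\<close>

definition rigid :: "nat \<Rightarrow> (nat \<Rightarrow> nat) set \<Rightarrow> (nat stream \<Rightarrow> nat stream) \<Rightarrow> nat list \<Rightarrow> bool" where
  "rigid n H f u \<longleftrightarrow>
     (\<exists>u'\<in>lists {1..n}. \<exists>\<sigma>\<in>H. \<forall>w\<in>cantor n. f (u @- w) = u' @- smap \<sigma> w)"

text \<open>The pointwise, partition-free form of membership in \<open>V_set\<close>: it passes to composites, inverses and
  glued maps without any common refinement of complete sets of branches. The map need only be
  meaningful near the point, so it also applies to bijections between parts of the Cantor space.\<close>

definition tame :: "nat \<Rightarrow> (nat \<Rightarrow> nat) set \<Rightarrow> (nat stream \<Rightarrow> nat stream) \<Rightarrow> nat stream \<Rightarrow> bool" where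
  "tame n H f x \<longleftrightarrow> (\<exists>u\<in>lists {1..n}. x \<in> branch n u \<and> rigid n H f u)"

definition branch_open :: "nat \<Rightarrow> nat stream set \<Rightarrow> bool" where
  "branch_open n D \<longleftrightarrow> (\<forall>x\<in>D. \<exists>v\<in>lists {1..n}. x \<in> branch n v \<and> branch n v \<subseteq> D)"

locale alphabet =
  fixes n :: nat
  assumes two_le: "2 \<le> n"

locale label_group = alphabet +
  fixes H :: "(nat \<Rightarrow> nat) set"
  assumes sub: "subgroup H (sym_group n)"
begin

lemma perm: "\<sigma> \<in> H \<Longrightarrow> \<sigma> permutes {1..n}"
  using subgroup.mem_carrier[OF sub] by (simp add: sym_group_carrier)

lemma id_in_H: "id \<in> H"
  using subgroup.one_closed[OF sub] by (simp add: sym_group_one)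

lemma comp_in_H: "\<sigma> \<in> H \<Longrightarrow> \<tau> \<in> H \<Longrightarrow> \<sigma> \<circ> \<tau> \<in> H"
  using subgroup.m_closed[OF sub] by (simp add: sym_group_mult)

lemma inv_in_H:
  assumes "\<sigma> \<in> H"
  shows "Hilbert_Choice.inv \<sigma> \<in> H"
  using subgroup.m_inv_closed[OF sub assms] subgroup.mem_carrier[OF sub assms]
  by (simp add: sym_group_inv_equality)

lemma smap_in_cantor: "\<sigma> \<in> H \<Longrightarrow> w \<in> cantor n \<Longrightarrow> smap \<sigma> w \<in> cantor n"
  using perm by (auto intro!: smap_streams dest: permutes_in_image)

lemma map_in_lists: "\<sigma> \<in> H \<Longrightarrow> v \<in> lists {1..n} \<Longrightarrow> map \<sigma> v \<in> lists {1..n}"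
  using permutes_in_image[OF perm] by (force simp: in_lists_conv_set)

lemma smap_inv_cancel: "\<sigma> \<in> H \<Longrightarrow> smap \<sigma> (smap (Hilbert_Choice.inv \<sigma>) w) = w"
  by (simp only: stream.map_comp permutes_inv_o(1)[OF perm] stream.map_id)

lemma rigid_append:
  assumes "rigid n H f u" "v \<in> lists {1..n}"
  shows "rigid n H f (u @ v)"
proof -
  obtain u' \<sigma> where *: "u' \<in> lists {1..n}" "\<sigma> \<in> H"
    "\<And>w. w \<in> cantor n \<Longrightarrow> f (u @- w) = u' @- smap \<sigma> w"
    using assms(1) unfolding rigid_def by blast
  have "\<forall>w\<in>cantor n. f ((u @ v) @- w) = (u' @ map \<sigma> v) @- smap \<sigma> w"
    using *(3) assms(2) by (simp add: shift_streams)
  moreover have "u' @ map \<sigma> v \<in> lists {1..n}"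
    using *(1) map_in_lists[OF *(2) assms(2)] by (metis append_in_lists_conv)
  ultimately show ?thesis
    unfolding rigid_def using *(2) by blast
qed

lemma image_branch:
  assumes \<sigma>: "\<sigma> \<in> H" and f: "\<And>w. w \<in> cantor n \<Longrightarrow> f (u @- w) = u' @- smap \<sigma> w"
  shows "f ` branch n u = branch n u'"
proof -
  have "smap \<sigma> ` cantor n = cantor n"
    using smap_in_cantor[OF \<sigma>] smap_in_cantor[OF inv_in_H[OF \<sigma>]] smap_inv_cancel[OF \<sigma>]
    by (metis (no_types, lifting) image_eqI image_subsetI subsetI subset_antisym)
  then show ?thesis
    unfolding branch_eq_image image_image using f
    by (metis (no_types, lifting) image_cong image_image)
qed

lemma rigid_image:
  assumes "rigid n H f u"
  obtains u' where "u' \<in> lists {1..n}" "f ` branch n u = branch n u'"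
  using assms image_branch unfolding rigid_def by metis

lemma rigid_cong:
  assumes "rigid n H f u" "\<And>x. x \<in> branch n u \<Longrightarrow> h x = f x"
  shows "rigid n H h u"
  using assms unfolding rigid_def by (metis shift_in_branch)

lemma tame_refine:
  assumes "tame n H f x" "v \<in> lists {1..n}" "x \<in> branch n v"
  obtains u where "u \<in> lists {1..n}" "x \<in> branch n u" "branch n u \<subseteq> branch n v" "rigid n H f u"
proof -
  obtain u where u: "u \<in> lists {1..n}" "x \<in> branch n u" "rigid n H f u"
    using assms(1) unfolding tame_def by blast
  show ?thesis
  proof (cases "length v \<le> length u")
    case True
    then show ?thesis
      using nested_words[OF assms(3) u(2) True assms(2) u(1)] that[OF u(1,2) _ u(3)]
        branch_append_subset by metis
  next
    case False
    then obtain v' where "v' \<in> lists {1..n}" "v = u @ v'"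
      using nested_words[OF u(2) assms(3) _ u(1) assms(2)] by auto
    then show ?thesis
      using that[OF assms(2,3)] rigid_append[OF u(3)] by blast
  qed
qed

lemma tame_cong:
  assumes "tame n H f x" "branch_open n D" "x \<in> D" "\<And>y. y \<in> D \<Longrightarrow> h y = f y"
  shows "tame n H h x"
proof -
  obtain v where v: "v \<in> lists {1..n}" "x \<in> branch n v" "branch n v \<subseteq> D"
    using assms(2,3) unfolding branch_open_def by blast
  obtain u where u: "u \<in> lists {1..n}" "x \<in> branch n u" "branch n u \<subseteq> branch n v" "rigid n H f u"
    using tame_refine[OF assms(1) v(1,2)] .
  then show ?thesis
    unfolding tame_def using v(3) assms(4) rigid_cong[OF u(4), of h] by blast
qed

lemma tame_id: "x \<in> cantor n \<Longrightarrow> tame n H (\<lambda>x. x) x"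
  unfolding tame_def rigid_def
  by (intro bexI[of _ "[]"] conjI bexI[of _ id]) (auto simp: id_in_H stream.map_id)

lemma tame_in_cantor:
  assumes "tame n H f x" shows "x \<in> cantor n" "f x \<in> cantor n"
proof -
  obtain u u' \<sigma> w where *: "u \<in> lists {1..n}" "u' \<in> lists {1..n}" "\<sigma> \<in> H" "w \<in> cantor n"
    "x = u @- w" "f (u @- w) = u' @- smap \<sigma> w"
    using assms unfolding tame_def rigid_def branch_def by blast
  then show "x \<in> cantor n" "f x \<in> cantor n"
    by (auto simp: shift_streams smap_in_cantor)
qed

text \<open>Below a word where the map is rigid, each further letter of the argument determines one more letter of the
  image, so a long enough prefix of the point has an image word below any given branch around the
  image point.\<close>

lemma tame_below:
  assumes "tame n H f x" "v \<in> lists {1..n}" "f x \<in> branch n v"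
  obtains u v' \<sigma> where "u \<in> lists {1..n}" "x \<in> branch n u" "v' \<in> lists {1..n}" "\<sigma> \<in> H"
    "\<And>w. w \<in> cantor n \<Longrightarrow> f (u @- w) = v @- v' @- smap \<sigma> w"
proof -
  obtain u u' \<sigma> w where *: "u \<in> lists {1..n}" "u' \<in> lists {1..n}" "\<sigma> \<in> H" "w \<in> cantor n"
    "x = u @- w" "\<And>w. w \<in> cantor n \<Longrightarrow> f (u @- w) = u' @- smap \<sigma> w"
    using assms(1) unfolding tame_def rigid_def branch_def by blast
  define p where "p = stake (length v) w"
  have p: "p \<in> lists {1..n}" using stake_in_lists[OF *(4)] by (simp add: p_def)
  define u1 where "u1 = u' @ map \<sigma> p"
  have u1: "u1 \<in> lists {1..n}"
    using *(2) map_in_lists[OF *(3) p] unfolding u1_def by (metis append_in_lists_conv)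
  have eq: "f ((u @ p) @- z) = u1 @- smap \<sigma> z" if "z \<in> cantor n" for z
    using *(6) p that by (simp add: shift_streams u1_def)
  have x: "x = (u @ p) @- sdrop (length v) w"
    by (simp add: *(5) p_def stake_sdrop)
  have "f x \<in> branch n u1"
    using eq[OF sdrop_in_cantor[OF *(4)]] x
    by (metis shift_in_branch smap_in_cantor[OF *(3) sdrop_in_cantor[OF *(4)]])
  then obtain v' where v': "v' \<in> lists {1..n}" "u1 = v @ v'"
    using nested_words[OF assms(3) _ _ assms(2) u1] by (auto simp: u1_def p_def)
  show ?thesis
  proof (rule that)
    show "u @ p \<in> lists {1..n}" using *(1) p by simp
    show "x \<in> branch n (u @ p)"
      unfolding x by (rule shift_in_branch[OF sdrop_in_cantor[OF *(4)]])
  qed (use v' eq *(3) in auto)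
qed

lemma tame_comp:
  assumes "tame n H f x" "tame n H g (f x)"
  shows "tame n H (\<lambda>x. g (f x)) x"
proof -
  obtain v v1 \<tau> where v: "v \<in> lists {1..n}" "f x \<in> branch n v" "v1 \<in> lists {1..n}" "\<tau> \<in> H"
    "\<And>w. w \<in> cantor n \<Longrightarrow> g (v @- w) = v1 @- smap \<tau> w"
    using assms(2) unfolding tame_def rigid_def by blast
  obtain u v' \<sigma> where u: "u \<in> lists {1..n}" "x \<in> branch n u" "v' \<in> lists {1..n}" "\<sigma> \<in> H"
    "\<And>w. w \<in> cantor n \<Longrightarrow> f (u @- w) = v @- v' @- smap \<sigma> w"
    using tame_below[OF assms(1) v(1,2)] by blast
  have "g (f (u @- w)) = (v1 @ map \<tau> v') @- smap (\<tau> \<circ> \<sigma>) w" if "w \<in> cantor n" for w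
    using u(3,5) v(5) that smap_in_cantor[OF u(4) that] by (simp add: shift_streams stream.map_comp)
  moreover have "v1 @ map \<tau> v' \<in> lists {1..n}"
    using v(3) map_in_lists[OF v(4) u(3)] by (metis append_in_lists_conv)
  ultimately have "rigid n H (\<lambda>x. g (f x)) u"
    unfolding rigid_def using comp_in_H[OF v(4) u(4)] by blast
  then show ?thesis
    unfolding tame_def using u(1,2) by blast
qed

lemma branch_open_vimage:
  assumes "\<And>x. x \<in> cantor n \<Longrightarrow> tame n H f x" "branch_open n D"
  shows "branch_open n {x \<in> cantor n. f x \<in> D}"
  unfolding branch_open_def
proof
  fix x assume x: "x \<in> {x \<in> cantor n. f x \<in> D}"
  then obtain v where v: "v \<in> lists {1..n}" "f x \<in> branch n v" "branch n v \<subseteq> D"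
    using assms(2) unfolding branch_open_def by blast
  obtain u v' \<sigma> where u: "u \<in> lists {1..n}" "x \<in> branch n u" "v' \<in> lists {1..n}" "\<sigma> \<in> H"
    "\<And>w. w \<in> cantor n \<Longrightarrow> f (u @- w) = v @- v' @- smap \<sigma> w"
    using tame_below[of f x, OF assms(1) v(1,2)] x by blast
  have "f (u @- w) \<in> D" if "w \<in> cantor n" for w
    using u(3,5) v(3) that smap_in_cantor[OF u(4) that]
    by (metis shift_in_branch shift_streams subsetD)
  then have "branch n u \<subseteq> {x \<in> cantor n. f x \<in> D}"
    using branch_subset_cantor[OF u(1)] by (auto simp: branch_def)
  then show "\<exists>v\<in>lists {1..n}. x \<in> branch n v \<and> branch n v \<subseteq> {x \<in> cantor n. f x \<in> D}"
    using u(1,2) by blast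
qed

lemma tame_inverse:
  assumes "bij_betw f (cantor n) (cantor n)" "tame n H f x"
  shows "tame n H (inv_into (cantor n) f) (f x)"
proof -
  obtain u u' \<sigma> w where *: "u \<in> lists {1..n}" "u' \<in> lists {1..n}" "\<sigma> \<in> H" "w \<in> cantor n"
    "x = u @- w" "\<And>w. w \<in> cantor n \<Longrightarrow> f (u @- w) = u' @- smap \<sigma> w"
    using assms(2) unfolding tame_def rigid_def branch_def by blast
  let ?\<tau> = "Hilbert_Choice.inv \<sigma>"
  have "inv_into (cantor n) f (u' @- z) = u @- smap ?\<tau> z" if "z \<in> cantor n" for z
  proof -
    have z: "smap ?\<tau> z \<in> cantor n" using smap_in_cantor[OF inv_in_H[OF *(3)] that] .
    then have "u' @- z = f (u @- smap ?\<tau> z)"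
      using *(6) smap_inv_cancel[OF *(3)] by simp
    then show ?thesis
      using assms(1) z *(1) by (simp add: bij_betw_def inv_into_f_f shift_streams)
  qed
  then have "rigid n H (inv_into (cantor n) f) u'"
    unfolding rigid_def using *(1) inv_in_H[OF *(3)] by blast
  moreover have "f x \<in> branch n u'"
    using * smap_in_cantor by (simp add: shift_in_branch)
  ultimately show ?thesis unfolding tame_def using *(2) by blast
qed

subsection \<open>Compactness\<close>

text \<open>Koenig's lemma: if no depth worked below the empty word, one could descend forever through
  words below which no depth works; but every infinite word has a prefix at which the map is
  already rigid.\<close>

lemma uniform_depth:
  assumes tame: "\<And>x. x \<in> cantor n \<Longrightarrow> tame n H f x"
  obtains d where "\<And>u. u \<in> lists {1..n} \<Longrightarrow> d \<le> length u \<Longrightarrow> rigid n H f u"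
proof -
  define good where "good u \<longleftrightarrow> (\<exists>d. \<forall>v\<in>lists {1..n}. d \<le> length v \<longrightarrow> rigid n H f (u @ v))" for u
  have step: "\<exists>a\<in>{1..n}. \<not> good (u @ [a])" if "\<not> good u" for u
  proof (rule ccontr)
    assume "\<not> (\<exists>a\<in>{1..n}. \<not> good (u @ [a]))"
    then obtain d where d: "\<And>a v. a \<in> {1..n} \<Longrightarrow> v \<in> lists {1..n} \<Longrightarrow> d a \<le> length v \<Longrightarrow>
        rigid n H f ((u @ [a]) @ v)"
      unfolding good_def by metis
    have "rigid n H f (u @ v)" if v: "v \<in> lists {1..n}" "Suc (Max (d ` {1..n})) \<le> length v" for v
    proof -
      obtain a v' where v': "v = a # v'" using v(2) by (cases v) auto
      then have a: "a \<in> {1..n}" "v' \<in> lists {1..n}" using v(1) by auto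
      then have "d a \<le> Max (d ` {1..n})" by (intro Max_ge) auto
      then have "d a \<le> length v'" using v(2) v' by simp
      then show ?thesis using d[OF a] v' by simp
    qed
    then have "good u" unfolding good_def by blast
    then show False using that by blast
  qed
  have "good []"
  proof (rule ccontr)
    assume bad: "\<not> good []"
    define next_letter where "next_letter u = (SOME a. a \<in> {1..n} \<and> \<not> good (u @ [a]))" for u
    have nl: "next_letter u \<in> {1..n} \<and> \<not> good (u @ [next_letter u])" if "\<not> good u" for u
      unfolding next_letter_def using step[OF that] someI_ex[of "\<lambda>a. a \<in> {1..n} \<and> \<not> good (u @ [a])"]
      by blast
    define path where "path k = ((\<lambda>u. u @ [next_letter u]) ^^ k) []" for k
    have path_Suc: "path (Suc k) = path k @ [next_letter (path k)]" for k
      by (simp add: path_def)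
    have path_bad: "\<not> good (path k)" for k
    proof (induction k)
      case 0 then show ?case using bad by (simp add: path_def)
    next
      case (Suc k) then show ?case using nl path_Suc by simp
    qed
    define x where "x = smap (\<lambda>k. next_letter (path k)) nats"
    have "x \<in> cantor n"
      using nl[OF path_bad] by (simp add: x_def streams_iff_snth)
    have prefix: "stake k x = path k" for k
      by (induction k) (simp add: path_def, simp add: path_Suc stake_Suc x_def)
    obtain u where u: "u \<in> lists {1..n}" "x \<in> branch n u" "rigid n H f u"
      using tame[OF \<open>x \<in> cantor n\<close>] unfolding tame_def by blast
    have "path (length u) = u"
      using u(1,2) prefix by (metis in_branch_iff)
    moreover have "good u"
      unfolding good_def using rigid_append[OF u(3)] by blast
    ultimately show False using path_bad by metis
  qed
  then show ?thesis unfolding good_def using that by auto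
qed

text \<open>Compactness turns the local condition into a finite complete set, namely all words of one depth.\<close>

lemma V_set_iff:
  "g \<in> V_set n H \<longleftrightarrow> g \<in> Bij (cantor n) \<and> (\<forall>x\<in>cantor n. tame n H g x)"
proof
  assume "g \<in> V_set n H"
  then obtain \<B> where g: "g \<in> Bij (cantor n)" and \<B>: "complete_branches n \<B>"
    "\<forall>u\<in>lists {1..n}. branch n u \<in> \<B> \<longrightarrow>
             (\<exists>u'\<in>lists {1..n}. g ` branch n u = branch n u' \<and>
                (\<exists>\<sigma>\<in>H. \<forall>w\<in>cantor n. g (u @- w) = u' @- smap \<sigma> w))"
    by (auto simp: V_set_def)
  have "tame n H g x" if x: "x \<in> cantor n" for x
  proof -
    obtain B where B: "B \<in> \<B>" "x \<in> B"
      using x \<B>(1) unfolding complete_branches_def by blast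
    then obtain u where "u \<in> lists {1..n}" "B = branch n u"
      using \<B>(1) by (auto simp: complete_branches_def branches_def)
    then show ?thesis
      using B \<B>(2) unfolding tame_def rigid_def by blast
  qed
  then show "g \<in> Bij (cantor n) \<and> (\<forall>x\<in>cantor n. tame n H g x)" using g by blast
next
  assume g: "g \<in> Bij (cantor n) \<and> (\<forall>x\<in>cantor n. tame n H g x)"
  then obtain d where d: "\<And>u. u \<in> lists {1..n} \<Longrightarrow> d \<le> length u \<Longrightarrow> rigid n H g u"
    using uniform_depth by blast
  define A where "A = {u. set u \<subseteq> {1..n} \<and> length u = d}"
  have A: "A \<subseteq> lists {1..n}" by (auto simp: A_def lists_eq_set)
  have "finite A" unfolding A_def by (rule finite_lists_length_eq) simp
  then have "finite (branch n ` A)" by simp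
  moreover have "complete_branches n (branch n ` A)"
    unfolding complete_branches_def
  proof
    show "branch n ` A \<subseteq> branches n" using A by (auto simp: branches_def)
    have "cantor n \<subseteq> \<Union> (branch n ` A)"
    proof
      fix x assume x: "x \<in> cantor n"
      then have "stake d x \<in> A" using stake_in_lists[OF x, of d] by (simp add: A_def lists_eq_set)
      then show "x \<in> \<Union> (branch n ` A)" using in_branch_stake[OF x] by blast
    qed
    then show "\<Union> (branch n ` A) = cantor n"
      using A branch_subset_cantor by blast
  qed
  moreover have "pairwise (independent_branches n) (branch n ` A)"
    unfolding pairwise_def
  proof (intro ballI impI)
    fix B B' assume "B \<in> branch n ` A" "B' \<in> branch n ` A"
    then obtain u u' where u: "u \<in> A" "B = branch n u" "u' \<in> A" "B' = branch n u'" by blast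
    then have "length u = length u'" by (simp add: A_def)
    then have "\<not> strict_prefix u u'" "\<not> strict_prefix u' u"
      using prefix_length_less by fastforce+
    then show "independent_branches n B B'"
      unfolding independent_branches_def using u A by blast
  qed
  moreover have "\<exists>u'\<in>lists {1..n}. g ` branch n u = branch n u' \<and>
                (\<exists>\<sigma>\<in>H. \<forall>w\<in>cantor n. g (u @- w) = u' @- smap \<sigma> w)"
    if u: "u \<in> lists {1..n}" and "branch n u \<in> branch n ` A" for u
  proof -
    have "u \<in> A" using that branch_inject[OF two_le] A by blast
    then have "rigid n H g u" using d u by (simp add: A_def)
    then obtain u' \<sigma> where *: "u' \<in> lists {1..n}" "\<sigma> \<in> H"
      "\<forall>w\<in>cantor n. g (u @- w) = u' @- smap \<sigma> w"
      unfolding rigid_def by blast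
    have "g ` branch n u = branch n u'"
      using *(3) by (intro image_branch[OF *(2)]) blast
    then show ?thesis using * by blast
  qed
  ultimately show "g \<in> V_set n H"
    unfolding V_set_def using g by blast
qed

end

section \<open>Clopen sets and their size modulo n - 1\<close>

text \<open>Words of pairwise disjoint branches, that is, a finite prefix code; \<open>region\<close> is the clopen set that it cuts
  into branches.\<close>

definition code :: "nat \<Rightarrow> nat list set \<Rightarrow> bool" where
  "code n A \<longleftrightarrow> finite A \<and> A \<subseteq> lists {1..n} \<and>
     (\<forall>u\<in>A. \<forall>v\<in>A. u \<noteq> v \<longrightarrow> branch n u \<inter> branch n v = {})"

definition region :: "nat \<Rightarrow> nat list set \<Rightarrow> nat stream set" where
  "region n A = (\<Union>u\<in>A. branch n u)"

lemma codeD: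
  assumes "code n A"
  shows "finite A" "A \<subseteq> lists {1..n}"
    "\<And>u v x. u \<in> A \<Longrightarrow> v \<in> A \<Longrightarrow> x \<in> branch n u \<Longrightarrow> x \<in> branch n v \<Longrightarrow> u = v"
  using assms unfolding code_def by blast+

lemma region_subset_cantor: "A \<subseteq> lists {1..n} \<Longrightarrow> region n A \<subseteq> cantor n"
  using branch_subset_cantor by (auto simp: region_def)

lemma branch_open_region: "A \<subseteq> lists {1..n} \<Longrightarrow> branch_open n (region n A)"
  unfolding branch_open_def region_def by blast

lemma code_subset: "code n A \<Longrightarrow> B \<subseteq> A \<Longrightarrow> code n B"
  unfolding code_def by (meson finite_subset subset_eq)

lemma region_empty_iff:
  assumes "1 \<le> n"
  shows "region n A = {} \<longleftrightarrow> A = {}"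
  using branch_nonempty[OF assms] by (auto simp: region_def)

lemma region_inter:
  assumes "code n A" "B \<subseteq> A" "B' \<subseteq> A" "B \<inter> B' = {}"
  shows "region n B \<inter> region n B' = {}"
  using codeD(3)[OF assms(1)] assms(2-4) unfolding region_def by blast

lemma code_length_bound:
  assumes "code n A"
  obtains D where "d \<le> D" "\<And>u. u \<in> A \<Longrightarrow> length u \<le> D"
proof
  show "d \<le> Max (insert d (length ` A))" using codeD(1)[OF assms] by (intro Max_ge) auto
  show "length u \<le> Max (insert d (length ` A))" if "u \<in> A" for u
    using that codeD(1)[OF assms] by (intro Max_ge) auto
qed

context alphabet
begin

lemma card_stake_branch:
  assumes "u \<in> lists {1..n}" "length u \<le> D"
  shows "finite (stake D ` branch n u)" "card (stake D ` branch n u) = n ^ (D - length u)"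
proof -
  define L where "L = {v. set v \<subseteq> {1..n} \<and> length v = D - length u}"
  have L: "finite L" "card L = n ^ (D - length u)"
    unfolding L_def by (auto simp: finite_lists_length_eq card_lists_length_eq)
  have "stake D ` branch n u = (@) u ` L"
  proof (intro equalityI subsetI)
    fix y assume "y \<in> stake D ` branch n u"
    then obtain w where w: "w \<in> cantor n" "y = stake D (u @- w)"
      by (auto simp: branch_def)
    then have "y = u @ stake (D - length u) w"
      using assms(2) by (simp add: stake_shift)
    moreover have "stake (D - length u) w \<in> L"
      using stake_in_lists[OF w(1)] by (simp add: L_def lists_eq_set)
    ultimately show "y \<in> (@) u ` L" by blast
  next
    fix y assume "y \<in> (@) u ` L"
    then obtain v where v: "v \<in> L" "y = u @ v" by blast
    obtain w where w: "w \<in> cantor n" using cantor_nonempty[of n] two_le by auto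
    have "v @- w \<in> cantor n" using v(1) w by (auto simp: L_def lists_eq_set intro!: shift_streams)
    then have "u @- v @- w \<in> branch n u" by (rule shift_in_branch)
    moreover have "stake D (u @- v @- w) = y"
      using v assms(2) by (auto simp: L_def stake_shift)
    ultimately show "y \<in> stake D ` branch n u" by (metis image_eqI)
  qed
  then show "finite (stake D ` branch n u)" "card (stake D ` branch n u) = n ^ (D - length u)"
    using L by (auto simp: card_image inj_on_def)
qed

lemma pow_cong_1: "[n ^ k = 1] (mod (n - 1))"
proof -
  have "n = (n - 1) + 1" using two_le by simp
  then have "[n = 1] (mod (n - 1))" by (metis cong_add_rcancel_0_nat cong_refl cong_0_iff dvd_refl)
  then show ?thesis using cong_pow[of n 1 "n - 1" k] by simp
qed

text \<open>Replacing each word of a code by its extensions of a large common length turns one word into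
  \<open>n ^ k\<close> words, and \<open>n \<equiv> 1\<close> modulo \<open>n - 1\<close>.\<close>

lemma subdivide:
  assumes A: "code n A" and D: "\<And>u. u \<in> A \<Longrightarrow> length u \<le> D"
  defines "S \<equiv> stake D ` region n A"
  shows "code n S" "region n S = region n A" "[card S = card A] (mod (n - 1))"
proof -
  note cD = codeD[OF A]
  have S: "S = (\<Union>u\<in>A. stake D ` branch n u)"
    unfolding S_def region_def by blast
  have lists: "S \<subseteq> lists {1..n}"
    unfolding S_def using region_subset_cantor[OF cD(2)] stake_in_lists by blast
  have move: "y \<in> branch n u" if "u \<in> A" "x \<in> branch n u" "y \<in> cantor n" "stake D x = stake D y" for u x y
  proof -
    have u: "u \<in> lists {1..n}" "length u \<le> D" using that(1) cD(2) D by auto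
    then have "stake (length u) y = stake (length u) x"
      using that(4) by (metis min.absorb1 take_stake)
    then show ?thesis using that(2,3) by (simp add: in_branch_iff[OF u(1)])
  qed
  have fin: "finite S" unfolding S using cD(1,2) D card_stake_branch(1) by blast
  moreover have "x = y" if "x \<in> S" "y \<in> S" "z \<in> branch n x" "z \<in> branch n y" for x y z
  proof -
    have "length x = D" "length y = D" using that(1,2) by (auto simp: S_def)
    then show ?thesis using that lists by (metis in_branch_iff subsetD)
  qed
  ultimately show "code n S" unfolding code_def using lists by blast
  show "region n S = region n A"
  proof (intro equalityI subsetI)
    fix y assume "y \<in> region n S"
    then obtain u x where ux: "u \<in> A" "x \<in> branch n u" "y \<in> branch n (stake D x)"
      unfolding region_def S by blast
    have "stake D x \<in> S" unfolding S using ux by blast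
    then have "y \<in> cantor n \<and> stake D x = stake D y"
      using ux(3) in_branch_iff[of "stake D x" n y] lists by auto
    then show "y \<in> region n A"
      unfolding region_def using move[OF ux(1,2)] ux(1) by blast
  next
    fix y assume y: "y \<in> region n A"
    have "y \<in> branch n (stake D y)"
      using y in_branch_stake region_subset_cantor[OF cD(2)] by blast
    moreover have "stake D y \<in> S" unfolding S_def using y by (rule imageI)
    ultimately show "y \<in> region n S" unfolding region_def[of n S] by blast
  qed
  have "card S = (\<Sum>u\<in>A. card (stake D ` branch n u))"
    unfolding S
  proof (rule card_UN_disjoint)
    show "finite A" by (rule cD(1))
    show "\<forall>u\<in>A. finite (stake D ` branch n u)" using cD(2) D card_stake_branch(1) by blast
    show "\<forall>u\<in>A. \<forall>v\<in>A. u \<noteq> v \<longrightarrow> stake D ` branch n u \<inter> stake D ` branch n v = {}"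
      using move cD(2,3) branch_subset_cantor by (smt (verit, ccfv_threshold) disjoint_iff image_iff subsetD)
  qed
  also have "\<dots> = (\<Sum>u\<in>A. n ^ (D - length u))"
    using card_stake_branch(2) D cD(2) by (intro sum.cong) auto
  also have "[\<dots> = (\<Sum>u\<in>A. 1)] (mod (n - 1))"
    by (rule cong_sum) (rule pow_cong_1)
  finally show "[card S = card A] (mod (n - 1))" by simp
qed

text \<open>So a clopen set has a size in the integers modulo \<open>n - 1\<close>: the number of branches in any of its
  partitions into branches. The whole Cantor space has size 1.\<close>

lemma card_cong_if_region_eq:
  assumes "code n A" "code n B" "region n A = region n B"
  shows "[card A = card B] (mod (n - 1))"
proof -
  obtain d where d: "\<And>u. u \<in> A \<Longrightarrow> length u \<le> d" using code_length_bound[OF assms(1), of 0] by blast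
  obtain D where D: "d \<le> D" "\<And>u. u \<in> B \<Longrightarrow> length u \<le> D" using code_length_bound[OF assms(2), of d] by blast
  have "[card (stake D ` region n A) = card A] (mod (n - 1))"
    by (rule subdivide[OF assms(1)]) (use d D(1) le_trans in blast)
  moreover have "[card (stake D ` region n B) = card B] (mod (n - 1))"
    by (rule subdivide[OF assms(2) D(2)])
  ultimately show ?thesis unfolding assms(3) by (metis cong_sym cong_trans)
qed

lemma code_Nil: "code n {[]}" and region_Nil: "region n {[]} = cantor n"
  by (auto simp: code_def region_def)

lemma card_complete_code:
  assumes "code n A" "region n A = cantor n"
  shows "[card A = 1] (mod (n - 1))"
  using card_cong_if_region_eq[OF assms(1) code_Nil] assms(2) region_Nil by (simp add: One_nat_def)

lemma split_word:
  assumes A: "code n A" and u: "u \<in> A"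
  defines "B \<equiv> (A - {u}) \<union> (\<lambda>a. u @ [a]) ` {1..n}"
  shows "code n B" "region n B = region n A" "card B = card A + (n - 1)"
proof -
  note cD = codeD[OF A]
  have ul: "u \<in> lists {1..n}" using u cD(2) by blast
  let ?K = "(\<lambda>a. u @ [a]) ` {1..n}"
  have K: "?K \<subseteq> lists {1..n}" using ul by auto
  have K_sub: "branch n v \<subseteq> branch n u" if "v \<in> ?K" for v
  proof -
    from that obtain a where "a \<in> {1..n}" "v = u @ [a]" by blast
    then show ?thesis using branch_append_subset[of "[a]" n u] by simp
  qed
  have K_un: "branch n u \<subseteq> region n ?K"
  proof
    fix x assume x: "x \<in> branch n u"
    then obtain w where w: "w \<in> cantor n" "x = u @- w" by (auto simp: branch_def)
    then have "shd w \<in> {1..n}" "stl w \<in> cantor n" by (auto elim: streamsE)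
    moreover have "x = (u @ [shd w]) @- stl w" using w by simp
    ultimately show "x \<in> region n ?K"
      unfolding region_def by (metis UN_I image_eqI shift_in_branch)
  qed
  have K_dis: "a = b" if "x \<in> branch n (u @ [a])" "x \<in> branch n (u @ [b])" for x a b
    using that by (auto simp: branch_def)
  have not_K: "v \<notin> A - {u}" if "v \<in> ?K" for v
  proof
    assume "v \<in> A - {u}"
    moreover obtain x where "x \<in> branch n v" using branch_nonempty[of n v] two_le by auto
    ultimately show False using K_sub[OF that] cD(3)[of v u x] u by blast
  qed
  show "code n B"
    unfolding code_def
  proof (intro conjI ballI impI)
    show "finite B" using cD(1) by (simp add: B_def)
    show "B \<subseteq> lists {1..n}" using cD(2) K by (auto simp: B_def)
    fix v v' assume v: "v \<in> B" "v' \<in> B" "v \<noteq> v'"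
    show "branch n v \<inter> branch n v' = {}"
    proof (rule ccontr)
      assume "branch n v \<inter> branch n v' \<noteq> {}"
      then obtain x where x: "x \<in> branch n v" "x \<in> branch n v'" by blast
      have out: "w \<notin> A - {u}" if "x \<in> branch n w" "w' \<in> ?K" "x \<in> branch n w'" for w w'
        using cD(3)[of w u x] K_sub[OF that(2)] that u by blast
      consider "v \<in> A - {u}" "v' \<in> A - {u}" | "v \<in> ?K" "v' \<in> ?K"
        using v(1,2) out x unfolding B_def by blast
      then show False
        using cD(3)[OF _ _ x] K_dis v(3) x by cases auto
    qed
  qed
  have "region n B = region n (A - {u}) \<union> region n ?K" by (auto simp: B_def region_def)
  moreover have "region n A = region n (A - {u}) \<union> branch n u" using u by (auto simp: region_def)
  moreover have "region n ?K \<subseteq> branch n u" using K_sub unfolding region_def by blast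
  ultimately show "region n B = region n A" using K_un by blast
  have "card B = card (A - {u}) + card ?K"
    unfolding B_def using cD(1) not_K by (intro card_Un_disjoint) auto
  moreover have "card ?K = n" by (simp add: card_image inj_on_def)
  moreover have "card A > 0" using u cD(1) by (auto simp: card_gt_0_iff)
  ultimately show "card B = card A + (n - 1)"
    using u cD(1) two_le by (simp add: card_Diff_singleton)
qed

text \<open>Splitting one word into its \<open>n\<close> children adds \<open>n - 1\<close> words and can be repeated, so the count of
  branches in a nonempty clopen set can be raised within its residue class.\<close>

lemma expand_code:
  assumes "code n A" "A \<noteq> {}"
  obtains B where "code n B" "region n B = region n A" "card B = card A + k * (n - 1)"
proof -
  have "\<exists>B. code n B \<and> region n B = region n A \<and> card B = card A + k * (n - 1)"
  proof (induction k)
    case 0 then show ?case using assms(1) by auto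
  next
    case (Suc k)
    then obtain B where B: "code n B" "region n B = region n A" "card B = card A + k * (n - 1)" by blast
    have "B \<noteq> {}" using B(2) assms(2) two_le by (metis region_empty_iff one_le_numeral order_trans)
    then obtain u where "u \<in> B" by blast
    then show ?case using split_word[OF B(1)] B(2,3) by fastforce
  qed
  then show ?thesis using that by blast
qed

lemma word_bijection_map:
  assumes A: "code n A" and B: "code n B" and \<pi>: "bij_betw \<pi> A B"
  obtains f where "bij_betw f (region n A) (region n B)"
    "\<And>u w. u \<in> A \<Longrightarrow> w \<in> cantor n \<Longrightarrow> f (u @- w) = \<pi> u @- w"
proof -
  define word where "word x = (THE u. u \<in> A \<and> x \<in> branch n u)" for x
  have word: "word x = u" if "u \<in> A" "x \<in> branch n u" for u x
    unfolding word_def using that codeD(3)[OF A] by blast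
  define f where "f x = \<pi> (word x) @- sdrop (length (word x)) x" for x
  have f: "f (u @- w) = \<pi> u @- w" if "u \<in> A" "w \<in> cantor n" for u w
    using word[OF that(1) shift_in_branch[OF that(2)]] by (simp add: f_def sdrop_shift)
  have "bij_betw f (region n A) (region n B)"
  proof (rule bij_betwI')
    fix x y assume "x \<in> region n A" "y \<in> region n A"
    then obtain u v w z where *: "u \<in> A" "v \<in> A" "w \<in> cantor n" "z \<in> cantor n" "x = u @- w" "y = v @- z"
      unfolding region_def branch_def by blast
    have "x = y" if "f x = f y"
    proof -
      have eq: "\<pi> u @- w = \<pi> v @- z" using that f * by simp
      have "\<pi> u @- w \<in> branch n (\<pi> u)" "\<pi> u @- w \<in> branch n (\<pi> v)"
        using shift_in_branch *(3,4) eq by metis+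
      then have "\<pi> u = \<pi> v" using codeD(3)[OF B] \<pi> *(1,2) by (metis bij_betwE)
      moreover from this have "u = v" using \<pi> *(1,2) by (metis bij_betw_inv_into_left)
      ultimately show ?thesis using eq * by simp
    qed
    then show "f x = f y \<longleftrightarrow> x = y" by blast
  next
    fix x assume "x \<in> region n A"
    then obtain u w where *: "u \<in> A" "w \<in> cantor n" "x = u @- w"
      unfolding region_def branch_def by blast
    then show "f x \<in> region n B"
      using f \<pi> unfolding region_def by (metis UN_I bij_betwE shift_in_branch)
  next
    fix y assume "y \<in> region n B"
    then obtain v w where *: "v \<in> B" "w \<in> cantor n" "y = v @- w"
      unfolding region_def branch_def by blast
    then obtain u where "u \<in> A" "\<pi> u = v" using \<pi> by (metis bij_betw_imp_surj_on imageE)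
    then show "\<exists>x\<in>region n A. y = f x"
      using f * unfolding region_def by (metis UN_I shift_in_branch)
  qed
  then show ?thesis using that f by blast
qed

end

context label_group
begin

lemma tame_word_map:
  assumes "A \<subseteq> lists {1..n}" "\<And>u w. u \<in> A \<Longrightarrow> w \<in> cantor n \<Longrightarrow> f (u @- w) = \<pi> u @- w"
    "\<pi> ` A \<subseteq> lists {1..n}" "x \<in> region n A"
  shows "tame n H f x"
proof -
  obtain u where u: "u \<in> A" "x \<in> branch n u" using assms(4) by (auto simp: region_def)
  have "\<forall>w\<in>cantor n. f (u @- w) = \<pi> u @- smap id w"
    using assms(2)[OF u(1)] by (simp add: stream.map_id)
  then show ?thesis
    unfolding tame_def rigid_def using u assms(1,3) id_in_H by blast
qed

text \<open>Conversely the size is the only invariant of a nonempty clopen set: after splitting, two codes of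
  congruent cardinalities have equally many words, and any bijection of the words extends to the
  branches by prefix replacement.\<close>

lemma regions_equivalent:
  assumes A: "code n A" and B: "code n B" and emp: "A = {} \<longleftrightarrow> B = {}"
    and cong: "[card A = card B] (mod (n - 1))"
  obtains f where "bij_betw f (region n A) (region n B)" "\<And>x. x \<in> region n A \<Longrightarrow> tame n H f x"
proof (cases "A = {}")
  case True
  then show ?thesis using that[of id] emp by (simp add: region_def)
next
  case False
  obtain k l where kl: "card B + k * (n - 1) = card A + l * (n - 1)"
    using cong unfolding cong_iff_lin_nat by blast
  obtain A' where A': "code n A'" "region n A' = region n A" "card A' = card A + l * (n - 1)"
    using expand_code[OF A False] .
  obtain B' where B': "code n B'" "region n B' = region n B" "card B' = card B + k * (n - 1)"
    using expand_code[OF B] False emp by metis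
  obtain \<pi> where \<pi>: "bij_betw \<pi> A' B'"
    using finite_same_card_bij[OF codeD(1)[OF A'(1)] codeD(1)[OF B'(1)]] A'(3) B'(3) kl by auto
  obtain f where f: "bij_betw f (region n A') (region n B')"
    "\<And>u w. u \<in> A' \<Longrightarrow> w \<in> cantor n \<Longrightarrow> f (u @- w) = \<pi> u @- w"
    using word_bijection_map[OF A'(1) B'(1) \<pi>] by blast
  have "\<pi> ` A' \<subseteq> lists {1..n}" using \<pi> codeD(2)[OF B'(1)] by (simp add: bij_betw_def)
  then have "tame n H f x" if "x \<in> region n A" for x
    using tame_word_map[OF codeD(2)[OF A'(1)] f(2)] that A'(2) by simp
  then show ?thesis using that[of f] f(1) A'(2) B'(2) by simp
qed

text \<open>The size is preserved by the group: after refining to the depth at which the map is rigid, it maps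
  the branches of one partition onto those of another.\<close>

lemma tame_image_card:
  assumes inj: "inj_on h (cantor n)" and tame: "\<And>x. x \<in> cantor n \<Longrightarrow> tame n H h x"
    and A: "code n A" and B: "code n B" and img: "h ` region n A = region n B"
  shows "[card A = card B] (mod (n - 1))"
proof -
  obtain d where d: "\<And>u. u \<in> lists {1..n} \<Longrightarrow> d \<le> length u \<Longrightarrow> rigid n H h u"
    using uniform_depth[OF tame] by blast
  obtain D where D: "d \<le> D" "\<And>u. u \<in> A \<Longrightarrow> length u \<le> D" using code_length_bound[OF A, of d] by blast
  define S where "S = stake D ` region n A"
  have S: "code n S" "region n S = region n A" "[card S = card A] (mod (n - 1))"
    using subdivide[OF A D(2)] unfolding S_def by blast+
  have "\<exists>v\<in>lists {1..n}. h ` branch n u = branch n v" if "u \<in> S" for u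
  proof -
    have "length u = D" using that by (auto simp: S_def)
    then have "rigid n H h u" using d D(1) that codeD(2)[OF S(1)] by blast
    then show ?thesis using rigid_image by blast
  qed
  then obtain \<nu> where \<nu>: "\<And>u. u \<in> S \<Longrightarrow> \<nu> u \<in> lists {1..n} \<and> h ` branch n u = branch n (\<nu> u)"
    by metis
  have dis: "u = v" if "u \<in> S" "v \<in> S" "y \<in> branch n (\<nu> u)" "y \<in> branch n (\<nu> v)" for u v y
  proof -
    have "y \<in> h ` branch n u" "y \<in> h ` branch n v" using that \<nu> by blast+
    then obtain x z where "x \<in> branch n u" "z \<in> branch n v" "y = h x" "y = h z" by blast
    moreover from this have "x \<in> cantor n" "z \<in> cantor n"
      using that(1,2) codeD(2)[OF S(1)] branch_subset_cantor by blast+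
    ultimately have "x = z" using inj by (metis inj_onD)
    then show ?thesis
      using codeD(3)[OF S(1) that(1,2)] \<open>x \<in> branch n u\<close> \<open>z \<in> branch n v\<close> by blast
  qed
  have "inj_on \<nu> S"
  proof (rule inj_onI)
    fix u v assume "u \<in> S" "v \<in> S" "\<nu> u = \<nu> v"
    moreover obtain y where "y \<in> branch n (\<nu> u)"
      using branch_nonempty[of n "\<nu> u"] two_le by auto
    ultimately show "u = v" using dis by metis
  qed
  then have "card (\<nu> ` S) = card S" by (rule card_image)
  moreover have "code n (\<nu> ` S)"
    unfolding code_def using codeD(1)[OF S(1)] \<nu> dis by blast
  moreover have "region n (\<nu> ` S) = region n B"
  proof -
    have "region n (\<nu> ` S) = (\<Union>u\<in>S. h ` branch n u)"
      using \<nu> unfolding region_def by auto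
    also have "\<dots> = h ` region n S" unfolding region_def by blast
    finally show ?thesis using S(2) img by simp
  qed
  ultimately have "[card S = card B] (mod (n - 1))"
    using card_cong_if_region_eq[OF _ B] by metis
  then show ?thesis using S(3) by (metis cong_sym cong_trans)
qed

end

section \<open>Orbits of maps of prime order\<close>

text \<open>A repetition would give a period \<open>k\<close> with \<open>0 < k < p\<close>; it is coprime to \<open>p\<close>, so by Bezout 1 would be a
  period as well.\<close>

lemma prime_orbit_inj:
  assumes p: "Factorial_Ring.prime p" and per: "(f ^^ p) a = a" and moved: "f a \<noteq> a"
  shows "inj_on (\<lambda>i. (f ^^ i) a) {..<p}"
proof -
  have fixed: "(f ^^ (k * x)) a = a" if "(f ^^ k) a = a" for k x
    using that by (induction x) (auto simp: funpow_add)
  have no_period: "(f ^^ k) a \<noteq> a" if k: "0 < k" "k < p" for k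
  proof
    assume *: "(f ^^ k) a = a"
    have "\<not> p dvd k" using k by (auto dest: dvd_imp_le)
    then have "gcd k p = 1"
      using p by (metis prime_imp_coprime coprime_commute coprime_iff_gcd_eq_1)
    then obtain x y where "k * x = p * y + 1" using bezout_nat[of k p] k(1) by auto
    then have "f ((f ^^ (p * y)) a) = a" using fixed[OF *, of x] by (simp add: One_nat_def)
    then show False using fixed[OF per] moved by simp
  qed
  have "i = j" if "i \<le> j" "j < p" "(f ^^ i) a = (f ^^ j) a" for i j
  proof (rule ccontr)
    assume "i \<noteq> j"
    then have "0 < p - j + i" "p - j + i < p" using that(1,2) by auto
    moreover have "(f ^^ (p - j + i)) a = (f ^^ (p - j)) ((f ^^ j) a)"
      using that(3) by (simp add: funpow_add)
    moreover have "\<dots> = (f ^^ (p - j + j)) a" by (simp only: funpow_add o_apply)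
    ultimately show False using no_period[of "p - j + i"] per that(2) by simp
  qed
  then show ?thesis by (intro inj_onI) (metis lessThan_iff nat_le_linear)
qed

text \<open>Choosing one representative in each orbit.\<close>

lemma free_transversal:
  assumes p: "Factorial_Ring.prime p"
    and M: "\<And>u. u \<in> M \<Longrightarrow> f u \<in> M" "\<And>u. u \<in> M \<Longrightarrow> (f ^^ p) u = u" "\<And>u. u \<in> M \<Longrightarrow> f u \<noteq> u"
  obtains T where "T \<subseteq> M" "bij_betw (\<lambda>(t, i). (f ^^ i) t) (T \<times> {..<p}) M"
proof -
  have p0: "0 < p" using p by (simp add: prime_gt_0_nat)
  define orb where "orb u = range (\<lambda>i. (f ^^ i) u)" for u
  define rep where "rep u = (SOME v. v \<in> orb u)" for u
  have orb_mod: "\<exists>i<p. v = (f ^^ i) u" if "u \<in> M" "v \<in> orb u" for u v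
  proof -
    from that(2) obtain k where "v = (f ^^ k) u" by (auto simp: orb_def)
    then have "v = (f ^^ (k mod p)) u" using funpow_mod_eq[OF M(2)[OF that(1)], of k] by simp
    then show ?thesis using p0 by (metis mod_less_divisor)
  qed
  have self: "u \<in> orb u" for u unfolding orb_def by (rule range_eqI[of _ _ 0]) simp
  have pow_M: "(f ^^ i) u \<in> M" if "u \<in> M" for u i
    using that M(1) by (induction i) auto
  have orb_M: "v \<in> M" if "u \<in> M" "v \<in> orb u" for u v
    using that pow_M by (auto simp: orb_def)
  have orb_sub: "orb v \<subseteq> orb u" if "v \<in> orb u" for u v
  proof
    fix z assume "z \<in> orb v"
    with that obtain i j where "z = (f ^^ i) ((f ^^ j) u)" by (auto simp: orb_def)
    then have "z = (f ^^ (i + j)) u" by (simp add: funpow_add)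
    then show "z \<in> orb u" by (auto simp: orb_def)
  qed
  have orb_sym: "u \<in> orb v" if u: "u \<in> M" and v: "v \<in> orb u" for u v
  proof -
    obtain i where i: "i < p" "v = (f ^^ i) u" using orb_mod[OF u v] by blast
    then have "(f ^^ (p - i)) v = (f ^^ (p - i + i)) u" by (simp only: funpow_add o_apply)
    then have "u = (f ^^ (p - i)) v" using i(1) M(2)[OF u] by simp
    then show ?thesis by (auto simp: orb_def)
  qed
  have orb_eq: "orb v = orb u" if "u \<in> M" "v \<in> orb u" for u v
    using orb_sub[OF that(2)] orb_sub[OF orb_sym[OF that]] by blast
  have rep: "rep u \<in> orb u" for u
    unfolding rep_def using self by (rule someI)
  have rep_eq: "rep v = rep u" if "u \<in> M" "v \<in> orb u" for u v
    unfolding rep_def orb_eq[OF that] ..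
  have T: "rep ` M \<subseteq> M" using orb_M rep by blast
  have "bij_betw (\<lambda>(t, i). (f ^^ i) t) (rep ` M \<times> {..<p}) M"
    unfolding bij_betw_def
  proof
    show "inj_on (\<lambda>(t, i). (f ^^ i) t) (rep ` M \<times> {..<p})"
    proof (rule inj_onI)
      fix a b assume "a \<in> rep ` M \<times> {..<p}" "b \<in> rep ` M \<times> {..<p}"
        and "(case a of (t, i) \<Rightarrow> (f ^^ i) t) = (case b of (t, i) \<Rightarrow> (f ^^ i) t)"
      then obtain u v i j where *: "u \<in> M" "v \<in> M" "a = (rep u, i)" "b = (rep v, j)" "i < p" "j < p"
        "(f ^^ i) (rep u) = (f ^^ j) (rep v)" by auto
      have uM: "rep u \<in> M" and vM: "rep v \<in> M" using T *(1,2) by auto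
      have "(f ^^ i) (rep u) \<in> orb (rep u)" "(f ^^ j) (rep v) \<in> orb (rep v)"
        by (auto simp: orb_def)
      then have "rep (rep u) = rep (rep v)" using rep_eq uM vM *(7) by metis
      then have eq: "rep u = rep v" using rep_eq rep *(1,2) by metis
      then have "i = j"
        using prime_orbit_inj[OF p M(2)[OF uM] M(3)[OF uM]] *(5-7) by (auto dest: inj_onD)
      then show "a = b" using eq * by simp
    qed
    show "(\<lambda>(t, i). (f ^^ i) t) ` (rep ` M \<times> {..<p}) = M"
    proof (intro equalityI subsetI)
      fix v assume v: "v \<in> M"
      then have rM: "rep v \<in> M" using T by blast
      obtain i where "i < p" "v = (f ^^ i) (rep v)"
        using orb_mod[OF rM orb_sym[OF v rep]] by blast
      then show "v \<in> (\<lambda>(t, i). (f ^^ i) t) ` (rep ` M \<times> {..<p})"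
        using v by (intro image_eqI[of _ _ "(rep v, i)"]) auto
    qed (use T pow_M in auto)
  qed
  then show ?thesis using that T by blast
qed

lemma small_permutation_trivial:
  assumes p: "Factorial_Ring.prime p" "n < p" and \<sigma>: "\<sigma> permutes {1..n}" and a: "a \<in> {1..n}" "(\<sigma> ^^ p) a = a"
  shows "\<sigma> a = a"
proof (rule ccontr)
  assume "\<sigma> a \<noteq> a"
  then have inj: "inj_on (\<lambda>i. (\<sigma> ^^ i) a) {..<p}" using prime_orbit_inj[OF p(1) a(2)] by blast
  have "(\<sigma> ^^ i) a \<in> {1..n}" for i
  proof (induction i)
    case (Suc i) then show ?case using permutes_in_image[OF \<sigma>] by simp
  qed (use a in simp)
  then have "(\<lambda>i. (\<sigma> ^^ i) a) ` {..<p} \<subseteq> {1..n}" by blast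
  from card_inj_on_le[OF inj this] show False using p(2) by simp
qed

section \<open>The group\<close>

context label_group
begin

lemma tame_agree:
  assumes "tame n H f x" "\<And>y. y \<in> cantor n \<Longrightarrow> h y = f y"
  shows "tame n H h x"
proof -
  obtain u where u: "u \<in> lists {1..n}" "x \<in> branch n u" "rigid n H f u"
    using assms(1) unfolding tame_def by blast
  then have "rigid n H h u"
    using rigid_cong[OF u(3), of h] assms(2) branch_subset_cantor[OF u(1)] by blast
  then show ?thesis using u unfolding tame_def by blast
qed

lemma V_setD:
  assumes "g \<in> V_set n H"
  shows "bij_betw g (cantor n) (cantor n)" "\<And>x. x \<in> cantor n \<Longrightarrow> tame n H g x"
    "g \<in> extensional (cantor n)" "g \<in> Bij (cantor n)"
  using assms by (auto simp: V_set_iff Bij_def)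

lemma V_setI:
  assumes "bij_betw f (cantor n) (cantor n)" "\<And>x. x \<in> cantor n \<Longrightarrow> tame n H f x"
  shows "restrict f (cantor n) \<in> V_set n H"
  unfolding V_set_iff
proof
  show "restrict f (cantor n) \<in> Bij (cantor n)"
    using assms(1) by (simp add: Bij_def)
  show "\<forall>x\<in>cantor n. tame n H (restrict f (cantor n)) x"
  proof
    fix x assume "x \<in> cantor n"
    from tame_agree[OF assms(2)[OF this]] show "tame n H (restrict f (cantor n)) x" by simp
  qed
qed

lemma V_set_subgroup: "subgroup (V_set n H) (BijGroup (cantor n))"
proof (rule group.subgroupI[OF group_BijGroup])
  show "V_set n H \<subseteq> carrier (BijGroup (cantor n))"
    using V_setD(4) by (auto simp: BijGroup_def)
  show "V_set n H \<noteq> {}"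
    using V_setI[of "\<lambda>x. x"] tame_id by (auto simp: bij_betw_def)
next
  fix g assume g: "g \<in> V_set n H"
  note gD = V_setD[OF g]
  have "tame n H (inv_into (cantor n) g) x" if "x \<in> cantor n" for x
  proof -
    have "inv_into (cantor n) g x \<in> cantor n"
      using bij_betw_inv_into[OF gD(1)] that by (rule bij_betw_apply)
    from tame_inverse[OF gD(1) gD(2)[OF this]] show ?thesis
      by (simp add: bij_betw_inv_into_right[OF gD(1) that])
  qed
  then show "m_inv (BijGroup (cantor n)) g \<in> V_set n H"
    unfolding inv_BijGroup[OF gD(4)] by (intro V_setI bij_betw_inv_into gD(1))
next
  fix g f assume gf: "g \<in> V_set n H" "f \<in> V_set n H"
  note gD = V_setD[OF gf(1)] and fD = V_setD[OF gf(2)]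
  have "restrict (g \<circ> f) (cantor n) \<in> V_set n H"
  proof (rule V_setI)
    show "bij_betw (g \<circ> f) (cantor n) (cantor n)" by (rule bij_betw_trans[OF fD(1) gD(1)])
    show "tame n H (g \<circ> f) x" if "x \<in> cantor n" for x
      unfolding comp_def by (rule tame_comp[OF fD(2)[OF that] gD(2)[OF tame_in_cantor(2)[OF fD(2)[OF that]]]])
  qed
  then show "g \<otimes>\<^bsub>BijGroup (cantor n)\<^esub> f \<in> V_set n H"
    using gD(4) fD(4) by (simp add: BijGroup_def compose_def comp_def restrict_def)
qed

lemma group_V: "group (V n H)"
  unfolding V_def by (rule group.subgroup_imp_group[OF group_BijGroup V_set_subgroup])

lemma carrier_V: "carrier (V n H) = V_set n H"
  by (simp add: V_def)

lemma V_mult: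
  assumes "g \<in> V_set n H" "f \<in> V_set n H"
  shows "g \<otimes>\<^bsub>V n H\<^esub> f = compose (cantor n) g f"
  using V_setD(4)[OF assms(1)] V_setD(4)[OF assms(2)] by (simp add: V_def BijGroup_def)

lemma V_one: "\<one>\<^bsub>V n H\<^esub> = (\<lambda>x\<in>cantor n. x)"
  by (simp add: V_def BijGroup_def)

lemma V_set_eqI:
  assumes "g \<in> V_set n H" "h \<in> V_set n H" "\<And>x. x \<in> cantor n \<Longrightarrow> g x = h x"
  shows "g = h"
  using extensionalityI[OF V_setD(3)[OF assms(1)] V_setD(3)[OF assms(2)]] assms(3) .

lemma V_in_cantor:
  assumes "g \<in> V_set n H" "x \<in> cantor n" shows "(g ^^ k) x \<in> cantor n"
  using V_setD(1)[OF assms(1)] assms(2) by (induction k) (auto dest: bij_betwE)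

lemma V_pow:
  assumes g: "g \<in> V_set n H"
  shows "g [^]\<^bsub>V n H\<^esub> (k::nat) \<in> V_set n H"
    "x \<in> cantor n \<Longrightarrow> (g [^]\<^bsub>V n H\<^esub> k) x = (g ^^ k) x"
proof -
  interpret V: group "V n H" by (rule group_V)
  show *: "g [^]\<^bsub>V n H\<^esub> k \<in> V_set n H" for k :: nat
    using V.nat_pow_closed[of g k] g by (simp add: carrier_V)
  show "(g [^]\<^bsub>V n H\<^esub> k) x = (g ^^ k) x" if "x \<in> cantor n"
    using that
  proof (induction k arbitrary: x)
    case 0 then show ?case by (simp add: V_one)
  next
    case (Suc k)
    have "g x \<in> cantor n" using V_in_cantor[OF g Suc.prems, of "Suc 0"] by simp
    then show ?case
      using Suc V_mult[OF *[of k] g] by (simp add: compose_def funpow_swap1)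
  qed
qed

lemma V_pow_tame:
  assumes "g \<in> V_set n H" "x \<in> cantor n" shows "tame n H (g ^^ k) x"
proof (induction k)
  case 0 show ?case using tame_id[OF assms(2)] by (simp add: id_def)
next
  case (Suc k)
  then show ?case
    using tame_comp[OF Suc V_setD(2)[OF assms(1) V_in_cantor[OF assms]]] by (simp add: comp_def)
qed

lemma V_pow_inj: "g \<in> V_set n H \<Longrightarrow> inj_on (g ^^ k) (cantor n)"
  using V_setD(1) by (metis bij_betw_funpow bij_betw_def)

section \<open>Torsion elements\<close>

text \<open>Labels are invertible, so rigidity of a composite on a branch can be carried over to the outer map on
  the image branch.\<close>

lemma rigid_transfer:
  assumes "rigid n H g u" "v \<in> lists {1..n}" "g ` branch n u = branch n v" "rigid n H (\<lambda>x. f (g x)) u"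
  shows "rigid n H f v"
proof -
  obtain u' \<sigma> where *: "u' \<in> lists {1..n}" "\<sigma> \<in> H"
    "\<And>w. w \<in> cantor n \<Longrightarrow> g (u @- w) = u' @- smap \<sigma> w"
    using assms(1) unfolding rigid_def by blast
  obtain u'' \<tau> where **: "u'' \<in> lists {1..n}" "\<tau> \<in> H"
    "\<And>w. w \<in> cantor n \<Longrightarrow> f (g (u @- w)) = u'' @- smap \<tau> w"
    using assms(4) unfolding rigid_def by blast
  let ?\<iota> = "Hilbert_Choice.inv \<sigma>"
  have \<iota>: "?\<iota> \<in> H" "smap ?\<iota> w \<in> cantor n" if "w \<in> cantor n" for w
    using inv_in_H[OF *(2)] smap_in_cantor that by blast+
  have eq: "g (u @- smap ?\<iota> w) = u' @- w" if "w \<in> cantor n" for w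
    using *(3)[OF \<iota>(2)[OF that]] smap_inv_cancel[OF *(2)] by simp
  have "branch n u' = branch n v" using image_branch[OF *(2,3)] assms(3) by simp
  then have "u' = v" using branch_inject[OF two_le *(1) assms(2)] by blast
  then have "f (v @- w) = u'' @- smap (\<tau> \<circ> ?\<iota>) w" if "w \<in> cantor n" for w
    using **(3)[OF \<iota>(2)[OF that]] eq[OF that] by (simp add: stream.map_comp)
  then show ?thesis
    unfolding rigid_def using **(1) comp_in_H[OF **(2) inv_in_H[OF *(2)]] by blast
qed

text \<open>The label \<open>\<sigma>\<close> of the map on the branch satisfies \<open>\<sigma> ^^ p = id\<close>. As \<open>p\<close> exceeds the number of letters, \<open>\<sigma>\<close>
  is trivial. This is the point where the label group disappears from the classification.\<close>

lemma fixed_branch_pointwise: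
  assumes p: "Factorial_Ring.prime p" "n < p" and u: "u \<in> lists {1..n}" and r: "rigid n H g u"
    and img: "g ` branch n u = branch n u" and per: "\<And>x. x \<in> cantor n \<Longrightarrow> (g ^^ p) x = x"
    and x: "x \<in> branch n u"
  shows "g x = x"
proof -
  obtain u' \<sigma> where *: "u' \<in> lists {1..n}" "\<sigma> \<in> H"
    "\<And>w. w \<in> cantor n \<Longrightarrow> g (u @- w) = u' @- smap \<sigma> w"
    using r unfolding rigid_def by blast
  have "branch n u' = branch n u" using image_branch[OF *(2,3)] img by simp
  then have "u' = u" using branch_inject[OF two_le *(1) u] by blast
  then have g: "g (u @- w) = u @- smap \<sigma> w" if "w \<in> cantor n" for w using *(3) that by simp
  have pow: "(g ^^ i) (u @- w) = u @- smap (\<sigma> ^^ i) w \<and> smap (\<sigma> ^^ i) w \<in> cantor n"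
    if "w \<in> cantor n" for w i
  proof (induction i)
    case 0 then show ?case using that by (simp add: stream.map_ident)
  next
    case (Suc i)
    moreover have "smap (\<sigma> ^^ Suc i) w = smap \<sigma> (smap (\<sigma> ^^ i) w)"
      by (simp add: stream.map_comp comp_def)
    ultimately show ?case
      using g smap_in_cantor[OF *(2)] by (simp del: funpow.simps(2) add: funpow.simps(2)[of i g])
  qed
  have \<sigma>: "\<sigma> a = a" if a: "a \<in> {1..n}" for a
  proof (rule small_permutation_trivial[OF p perm[OF *(2)] a])
    have w: "sconst a \<in> cantor n" using a by (simp add: streams_iff_snth)
    then have "u @- smap (\<sigma> ^^ p) (sconst a) = u @- sconst a"
      using pow[OF w, of p] per[OF shift_streams[OF u w]] by simp
    then have "smap (\<sigma> ^^ p) (sconst a) !! 0 = sconst a !! 0" by simp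
    then show "(\<sigma> ^^ p) a = a" by simp
  qed
  obtain w where w: "w \<in> cantor n" "x = u @- w" using x by (auto simp: branch_def)
  have "smap \<sigma> w = w"
    using w(1) \<sigma> by (simp add: smap_alt streams_iff_snth)
  then show ?thesis using g[OF w(1)] w(2) by simp
qed

text \<open>\<open>E\<close> is a fixed part, and \<open>D\<close> is a fundamental domain for the free action of the cyclic group of order \<open>p\<close>
  generated by \<open>g\<close> on the rest: each other point is \<open>(g ^^ i) x\<close> for exactly one \<open>x \<in> D\<close> and \<open>i < p\<close>.\<close>

definition fundamental :: "nat \<Rightarrow> (nat stream \<Rightarrow> nat stream) \<Rightarrow> nat stream set \<Rightarrow> nat stream set \<Rightarrow> bool" where
  "fundamental p g E D \<longleftrightarrow> E \<subseteq> cantor n \<and> (\<forall>x\<in>E. g x = x) \<and>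
     bij_betw (\<lambda>(x, i). (g ^^ i) x) (D \<times> {..<p}) (cantor n - E)"

text \<open>A torsion element permutes a partition of the Cantor space into branches. Consider the words on
  whose branches all powers of \<open>g\<close> are rigid. By compactness they contain all words of some depth, and
  \<open>g\<close> permutes their branches preserving inclusion, so it permutes the maximal ones among these.\<close>

lemma invariant_code:
  assumes g: "g \<in> V_set n H" and p: "0 < p" and per: "\<And>x. x \<in> cantor n \<Longrightarrow> (g ^^ p) x = x"
  obtains R \<pi> where "code n R" "region n R = cantor n" "\<And>u. u \<in> R \<Longrightarrow> rigid n H g u"
    "\<And>u. u \<in> R \<Longrightarrow> \<pi> u \<in> R" "\<And>u. u \<in> R \<Longrightarrow> (\<pi> ^^ p) u = u"
    "\<And>u. u \<in> R \<Longrightarrow> g ` branch n u = branch n (\<pi> u)"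
proof -
  define W where "W = {u \<in> lists {1..n}. \<forall>i. rigid n H (g ^^ i) u}"
  have Wl: "W \<subseteq> lists {1..n}" by (auto simp: W_def)
  have Wg: "rigid n H g u" if "u \<in> W" for u
    using that unfolding W_def by (auto dest!: spec[of _ "Suc 0"])
  have "\<exists>v. v \<in> W \<and> g ` branch n u = branch n v" if u: "u \<in> W" for u
  proof -
    obtain v where v: "v \<in> lists {1..n}" "g ` branch n u = branch n v"
      using rigid_image[OF Wg[OF u]] by blast
    have "rigid n H (g ^^ i) v" for i
    proof (rule rigid_transfer[OF Wg[OF u] v])
      have "rigid n H (g ^^ Suc i) u" using u unfolding W_def by blast
      then show "rigid n H (\<lambda>x. (g ^^ i) (g x)) u"
        by (rule rigid_cong) (simp add: funpow_swap1)
    qed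
    then show ?thesis using v by (auto simp: W_def)
  qed
  then obtain \<pi> where \<pi>: "\<And>u. u \<in> W \<Longrightarrow> \<pi> u \<in> W" "\<And>u. u \<in> W \<Longrightarrow> g ` branch n u = branch n (\<pi> u)"
    by metis
  have \<pi>_pow: "(\<pi> ^^ i) u \<in> W \<and> (g ^^ i) ` branch n u = branch n ((\<pi> ^^ i) u)" if "u \<in> W" for u i
  proof (induction i)
    case (Suc i)
    moreover have "(g ^^ Suc i) ` branch n u = g ` ((g ^^ i) ` branch n u)"
      by (simp add: image_comp)
    ultimately show ?case using \<pi> by simp
  qed (use that in simp)
  have per_image: "(g ^^ p) ` branch n u = branch n u" if u: "u \<in> W" for u
  proof -
    have "branch n u \<subseteq> cantor n" using branch_subset_cantor u Wl by blast
    then have "(g ^^ p) ` branch n u = (\<lambda>x. x) ` branch n u"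
      using per by (intro image_cong) auto
    then show ?thesis by simp
  qed
  have \<pi>_per: "(\<pi> ^^ p) u = u" if u: "u \<in> W" for u
  proof (rule branch_inject[OF two_le])
    show "branch n ((\<pi> ^^ p) u) = branch n u" using \<pi>_pow[OF u, of p] per_image[OF u] by simp
  qed (use \<pi>_pow[OF u, of p] u Wl in auto)
  have "\<exists>d. \<forall>u\<in>lists {1..n}. d \<le> length u \<longrightarrow> rigid n H (g ^^ i) u" for i
    by (rule uniform_depth[OF V_pow_tame[OF g, where k = i]]) blast+
  then obtain d where d: "\<And>i u. u \<in> lists {1..n} \<Longrightarrow> d i \<le> length u \<Longrightarrow> rigid n H (g ^^ i) u"
    by metis
  define D where "D = Max (d ` {..<p})"
  have deep: "u \<in> W" if u: "u \<in> lists {1..n}" "D \<le> length u" for u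
  proof -
    have "rigid n H (g ^^ i) u" for i
    proof -
      have "d (i mod p) \<le> D" unfolding D_def using p by (intro Max_ge) auto
      then have "rigid n H (g ^^ (i mod p)) u" using d u by simp
      then show ?thesis
        by (rule rigid_cong) (use funpow_mod_eq per branch_subset_cantor[OF u(1)] in \<open>metis subsetD\<close>)
    qed
    then show ?thesis using u by (simp add: W_def)
  qed
  \<comment> \<open>The words of the maximal branches. They are disjoint because branches that meet are nested.\<close>
  define R where "R = {u \<in> W. \<forall>v\<in>W. branch n u \<subseteq> branch n v \<longrightarrow> v = u}"
  have RW: "R \<subseteq> W" by (auto simp: R_def)
  have maximal: "v = u" if "u \<in> R" "v \<in> W" "branch n u \<subseteq> branch n v" for u v
    using that by (simp add: R_def)
  have short: "length u \<le> D" if u: "u \<in> R" for u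
  proof (rule ccontr)
    assume "\<not> length u \<le> D"
    then have len: "length (take D u) = D" by simp
    have ul: "take D u @ drop D u \<in> lists {1..n}" using u RW Wl by auto
    then have "take D u \<in> W" "branch n u \<subseteq> branch n (take D u)"
      using deep[of "take D u"] len branch_append_subset[of "drop D u" n "take D u"]
      unfolding append_in_lists_conv by auto
    then have "take D u = u" using maximal[OF u] by blast
    then show False using len \<open>\<not> length u \<le> D\<close> by simp
  qed
  have "finite R"
  proof (rule finite_subset)
    show "R \<subseteq> {u. set u \<subseteq> {1..n} \<and> length u \<le> D}"
      using short RW Wl unfolding lists_eq_set by blast
    show "finite {u. set u \<subseteq> {1..n} \<and> length u \<le> D}" by (rule finite_lists_length_le) simp
  qed
  have nested: "u = v" if uv: "u \<in> R" "v \<in> R" and x: "x \<in> branch n u" "x \<in> branch n v" for u v x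
  proof -
    have l: "u \<in> lists {1..n}" "v \<in> lists {1..n}" "u \<in> W" "v \<in> W" using uv RW Wl by auto
    have "branch n u \<subseteq> branch n v \<or> branch n v \<subseteq> branch n u"
      using nested_words[OF x _ l(1,2)] nested_words[OF x(2,1) _ l(2,1)] branch_append_subset
      by (metis nat_le_linear)
    then show ?thesis using maximal uv l(3,4) by metis
  qed
  have "code n R"
    unfolding code_def using \<open>finite R\<close> RW Wl nested by blast
  moreover have "region n R = cantor n"
  proof
    show "region n R \<subseteq> cantor n" using region_subset_cantor RW Wl by blast
    show "cantor n \<subseteq> region n R"
    proof
      fix x assume x: "x \<in> cantor n"
      \<comment> \<open>The shortest prefix of x in W spans a maximal branch.\<close>
      define k where "k = (LEAST k. stake k x \<in> W)"
      have "stake D x \<in> W" using deep[OF stake_in_lists[OF x]] by simp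
      then have k: "stake k x \<in> W" unfolding k_def by (rule LeastI)
      have "v = stake k x" if v: "v \<in> W" "branch n (stake k x) \<subseteq> branch n v" for v
      proof -
        have vl: "v \<in> lists {1..n}" using v(1) Wl by blast
        have eq: "stake (length v) x = v"
          using in_branch_iff[OF vl] v(2) in_branch_stake[OF x, of k] by blast
        then have "k \<le> length v" unfolding k_def using v(1) by (metis Least_le)
        moreover have "length v \<le> k"
          using branch_subset_imp_length_le[OF two_le stake_in_lists[OF x] vl v(2)] by simp
        ultimately show ?thesis using eq by (metis le_antisym)
      qed
      then have "stake k x \<in> R" using k by (simp add: R_def)
      then show "x \<in> region n R" unfolding region_def using in_branch_stake[OF x] by blast
    qed
  qed
  moreover have "\<pi> u \<in> R" if u: "u \<in> R" for u
  proof -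
    have uW: "u \<in> W" using u RW by blast
    have "v = \<pi> u" if v: "v \<in> W" "branch n (\<pi> u) \<subseteq> branch n v" for v
    proof -
      \<comment> \<open>Apply the inverse of g, which is a power of g, and use maximality of the branch of u.\<close>
      let ?v = "(\<pi> ^^ (p - 1)) v"
      have "branch n u = (g ^^ p) ` branch n u" using per_image[OF uW] by simp
      also have "\<dots> = (g ^^ (p - 1)) ` (g ` branch n u)"
        using funpow_Suc_right[of "p - 1" g] p by (simp add: image_comp)
      also have "\<dots> \<subseteq> (g ^^ (p - 1)) ` branch n v"
        using v(2) \<pi>(2)[OF uW] by (simp add: image_mono)
      also have "\<dots> = branch n ?v" using \<pi>_pow[OF v(1)] by blast
      finally have "?v = u" using maximal[OF u] \<pi>_pow[OF v(1)] by blast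
      then have "\<pi> u = (\<pi> ^^ p) v" using p by (metis Suc_diff_1 funpow.simps(2) o_apply)
      then show ?thesis using \<pi>_per[OF v(1)] by simp
    qed
    then show ?thesis using \<pi>(1)[OF uW] by (simp add: R_def)
  qed
  ultimately show ?thesis
    using that[of R \<pi>] RW Wg \<pi>(2) \<pi>_per by blast
qed

text \<open>In an invariant partition, the branches mapped to themselves are fixed pointwise and the others form
  orbits of length \<open>p\<close>; one branch from each such orbit makes up the fundamental domain.\<close>

lemma torsion_structure:
  assumes g: "g \<in> V_set n H" and p: "Factorial_Ring.prime p" "n < p" and per: "\<And>x. x \<in> cantor n \<Longrightarrow> (g ^^ p) x = x"
    and x0: "x0 \<in> cantor n" "g x0 \<noteq> x0"
  obtains F T where "code n F" "code n T" "T \<noteq> {}" "[card F + p * card T = 1] (mod (n - 1))"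
    "fundamental p g (region n F) (region n T)"
proof -
  obtain R \<pi> where R: "code n R" "region n R = cantor n" "\<And>u. u \<in> R \<Longrightarrow> rigid n H g u"
    and \<pi>: "\<And>u. u \<in> R \<Longrightarrow> \<pi> u \<in> R" "\<And>u. u \<in> R \<Longrightarrow> (\<pi> ^^ p) u = u"
    "\<And>u. u \<in> R \<Longrightarrow> g ` branch n u = branch n (\<pi> u)"
    using invariant_code[OF g prime_gt_0_nat[OF p(1)] per] by metis
  note cR = codeD[OF R(1)]
  define F where "F = {u \<in> R. \<pi> u = u}"
  define M where "M = {u \<in> R. \<pi> u \<noteq> u}"
  have RFM: "R = F \<union> M" "F \<inter> M = {}" "F \<subseteq> R" "M \<subseteq> R" by (auto simp: F_def M_def)
  have M: "\<pi> u \<in> M" "(\<pi> ^^ p) u = u" "\<pi> u \<noteq> u" if u: "u \<in> M" for u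
  proof -
    have "\<pi> (\<pi> u) \<noteq> \<pi> u"
    proof
      assume "\<pi> (\<pi> u) = \<pi> u"
      then have "(\<pi> ^^ k) (\<pi> u) = \<pi> u" for k by (induction k) auto
      from this[of "p - 1"] have "(\<pi> ^^ p) u = \<pi> u"
        using prime_gt_0_nat[OF p(1)] by (metis Suc_diff_1 funpow_Suc_right o_apply)
      then show False using u \<pi>(2) by (auto simp: M_def)
    qed
    then show "\<pi> u \<in> M" "(\<pi> ^^ p) u = u" "\<pi> u \<noteq> u" using u \<pi> by (auto simp: M_def)
  qed
  obtain T where T: "T \<subseteq> M" "bij_betw (\<lambda>(t, i). (\<pi> ^^ i) t) (T \<times> {..<p}) M"
    by (rule free_transversal[OF p(1) M]) blast+
  have pow: "(\<pi> ^^ i) u \<in> R \<and> (g ^^ i) ` branch n u = branch n ((\<pi> ^^ i) u)" if "u \<in> R" for u i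
  proof (induction i)
    case (Suc i)
    moreover have "(g ^^ Suc i) ` branch n u = g ` ((g ^^ i) ` branch n u)"
      by (simp add: image_comp)
    ultimately show ?case using \<pi> by simp
  qed (use that in simp)
  have codes: "code n F" "code n T"
    using code_subset[OF R(1)] RFM(3,4) T(1) by blast+
  have fixF: "g x = x" if "x \<in> region n F" for x
  proof -
    from that obtain u where u: "u \<in> F" "x \<in> branch n u" by (auto simp: region_def)
    then have uR: "u \<in> R" "g ` branch n u = branch n u" using \<pi>(3) by (auto simp: F_def)
    show ?thesis
      using fixed_branch_pointwise[OF p _ R(3)[OF uR(1)] uR(2) per u(2)] cR(2) uR(1) by blast
  qed
  have "T \<noteq> {}"
  proof
    assume "T = {}"
    then have "M = {}" using T(2) by (simp add: bij_betw_def)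
    then show False using fixF x0 R(2) RFM(1) by simp
  qed
  have "card M = p * card T"
    using bij_betw_same_card[OF T(2)] by (simp add: card_cartesian_product mult.commute)
  then have "card R = card F + p * card T"
    using RFM cR(1) by (metis card_Un_disjoint finite_Un)
  then have card: "[card F + p * card T = 1] (mod (n - 1))"
    using card_complete_code[OF R(1,2)] by simp
  have "fundamental p g (region n F) (region n T)"
    unfolding fundamental_def
  proof (intro conjI ballI)
    show "region n F \<subseteq> cantor n" using region_subset_cantor codeD(2)[OF codes(1)] by blast
    show "g x = x" if "x \<in> region n F" for x using fixF that .
    show "bij_betw (\<lambda>(x, i). (g ^^ i) x) (region n T \<times> {..<p}) (cantor n - region n F)"
      unfolding bij_betw_def
    proof
      show "inj_on (\<lambda>(x, i). (g ^^ i) x) (region n T \<times> {..<p})"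
      proof (rule inj_onI)
        fix a b assume "a \<in> region n T \<times> {..<p}" "b \<in> region n T \<times> {..<p}"
          "(case a of (x, i) \<Rightarrow> (g ^^ i) x) = (case b of (x, i) \<Rightarrow> (g ^^ i) x)"
        then obtain s t x y i j where *: "a = (x, i)" "b = (y, j)" "i < p" "j < p" "s \<in> T" "t \<in> T"
          "x \<in> branch n s" "y \<in> branch n t" "(g ^^ i) x = (g ^^ j) y"
          unfolding region_def by auto
        have st: "s \<in> R" "t \<in> R" using *(5,6) T(1) RFM(4) by auto
        have "(g ^^ i) x \<in> branch n ((\<pi> ^^ i) s)" "(g ^^ i) x \<in> branch n ((\<pi> ^^ j) t)"
          using pow[OF st(1), of i] pow[OF st(2), of j] *(7-9) by blast+
        then have "(\<pi> ^^ i) s = (\<pi> ^^ j) t" using cR(3) pow st by blast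
        then have "(s, i) = (t, j)"
          using T(2) *(3-6) unfolding bij_betw_def inj_on_def by force
        moreover have "x \<in> cantor n" "y \<in> cantor n"
          using *(7,8) st cR(2) branch_subset_cantor by blast+
        ultimately show "a = b"
          using V_pow_inj[OF g, of j] * by (auto dest: inj_onD)
      qed
      show "(\<lambda>(x, i). (g ^^ i) x) ` (region n T \<times> {..<p}) = cantor n - region n F"
      proof (intro equalityI subsetI)
        fix y assume "y \<in> (\<lambda>(x, i). (g ^^ i) x) ` (region n T \<times> {..<p})"
        then obtain t x i where *: "i < p" "t \<in> T" "x \<in> branch n t" "y = (g ^^ i) x"
          unfolding region_def by auto
        have tR: "t \<in> R" using *(2) T(1) RFM(4) by blast
        have yb: "y \<in> branch n ((\<pi> ^^ i) t)" using pow[OF tR, of i] *(3,4) by blast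
        moreover have "(\<pi> ^^ i) t \<in> M" using T(2) *(1,2) unfolding bij_betw_def by auto
        ultimately have "y \<in> region n M" unfolding region_def by blast
        moreover have "region n M \<subseteq> cantor n" using RFM(4) cR(2) region_subset_cantor by blast
        ultimately show "y \<in> cantor n - region n F"
          using region_inter[OF R(1) RFM(3,4,2)] by blast
      next
        fix y assume y: "y \<in> cantor n - region n F"
        then obtain u where u: "u \<in> M" "y \<in> branch n u"
          using R(2) RFM(1) unfolding region_def by blast
        obtain t i where ti: "t \<in> T" "i < p" "u = (\<pi> ^^ i) t"
          using T(2) u(1) unfolding bij_betw_def by auto
        have "t \<in> R" using ti(1) T(1) RFM(4) by blast
        then obtain x where "x \<in> branch n t" "y = (g ^^ i) x"
          using pow[of t i] u(2) ti(3) by blast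
        then show "y \<in> (\<lambda>(x, i). (g ^^ i) x) ` (region n T \<times> {..<p})"
          using ti(1,2) unfolding region_def by (intro image_eqI[of _ _ "(x, i)"]) auto
      qed
    qed
  qed
  then show ?thesis using that codes \<open>T \<noteq> {}\<close> card by blast
qed

end

section \<open>Conjugacy of elements of prime order\<close>

definition has_prime_order :: "('a, 'b) monoid_scheme \<Rightarrow> nat \<Rightarrow> 'a \<Rightarrow> bool" where
  "has_prime_order G p g \<longleftrightarrow> g \<in> carrier G \<and> g \<noteq> \<one>\<^bsub>G\<^esub> \<and> g [^]\<^bsub>G\<^esub> p = \<one>\<^bsub>G\<^esub>"

definition conjugate :: "('a, 'b) monoid_scheme \<Rightarrow> 'a \<Rightarrow> 'a \<Rightarrow> bool" where
  "conjugate G a b \<longleftrightarrow> (\<exists>h\<in>carrier G. h \<otimes>\<^bsub>G\<^esub> a = b \<otimes>\<^bsub>G\<^esub> h)"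

text \<open>The number of conjugacy classes of elements of order \<open>p\<close> enters only through the cardinalities of such sets
  of representatives.\<close>

definition nonconjugate_family :: "('a, 'b) monoid_scheme \<Rightarrow> nat \<Rightarrow> 'a set \<Rightarrow> bool" where
  "nonconjugate_family G p K \<longleftrightarrow>
     (\<forall>a\<in>K. has_prime_order G p a) \<and> (\<forall>a\<in>K. \<forall>b\<in>K. conjugate G a b \<longrightarrow> a = b)"

lemma iso_nonconjugate_family:
  assumes "group G" "group G'" "\<phi> \<in> iso G G'" "nonconjugate_family G p K"
  shows "nonconjugate_family G' p (\<phi> ` K)" "card (\<phi> ` K) = card K"
proof -
  interpret \<phi>: group_hom G G' \<phi>
    using assms(1-3) by (simp add: group_hom_def group_hom_axioms_def iso_def)
  have bij: "bij_betw \<phi> (carrier G) (carrier G')" using assms(3) by (simp add: iso_def)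
  have K: "K \<subseteq> carrier G" using assms(4) by (auto simp: nonconjugate_family_def has_prime_order_def)
  have inj: "x = y" if "x \<in> carrier G" "y \<in> carrier G" "\<phi> x = \<phi> y" for x y
    using bij that by (auto simp: bij_betw_def dest: inj_onD)
  show "card (\<phi> ` K) = card K" using inj K by (intro card_image inj_onI) blast
  show "nonconjugate_family G' p (\<phi> ` K)"
    unfolding nonconjugate_family_def
  proof (intro conjI ballI impI)
    fix b assume "b \<in> \<phi> ` K"
    then obtain a where a: "a \<in> K" "b = \<phi> a" by blast
    then have "a \<in> carrier G" "a \<noteq> \<one>\<^bsub>G\<^esub>" "a [^]\<^bsub>G\<^esub> p = \<one>\<^bsub>G\<^esub>"
      using assms(4) by (auto simp: nonconjugate_family_def has_prime_order_def)
    then show "has_prime_order G' p b"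
      using a(2) inj[of a "\<one>\<^bsub>G\<^esub>"] \<phi>.hom_nat_pow[of a p]
      by (auto simp: has_prime_order_def)
  next
    fix a b assume "a \<in> \<phi> ` K" "b \<in> \<phi> ` K" "conjugate G' a b"
    then obtain a' b' h where *: "a' \<in> K" "b' \<in> K" "a = \<phi> a'" "b = \<phi> b'"
      "h \<in> carrier G'" "h \<otimes>\<^bsub>G'\<^esub> a = b \<otimes>\<^bsub>G'\<^esub> h"
      by (auto simp: conjugate_def)
    obtain h' where h': "h' \<in> carrier G" "h = \<phi> h'"
      using bij *(5) by (auto simp: bij_betw_def)
    have ab: "a' \<in> carrier G" "b' \<in> carrier G" using *(1,2) K by auto
    have "\<phi> (h' \<otimes>\<^bsub>G\<^esub> a') = \<phi> (b' \<otimes>\<^bsub>G\<^esub> h')" using * h' ab by simp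
    then have "h' \<otimes>\<^bsub>G\<^esub> a' = b' \<otimes>\<^bsub>G\<^esub> h'" using inj h'(1) ab by simp
    then have "conjugate G a' b'" using h'(1) by (auto simp: conjugate_def)
    then show "a = b" using * assms(4) by (auto simp: nonconjugate_family_def)
  qed
qed

context label_group
begin

lemma has_prime_order_V_iff:
  "has_prime_order (V n H) p g \<longleftrightarrow>
     g \<in> V_set n H \<and> (\<forall>x\<in>cantor n. (g ^^ p) x = x) \<and> (\<exists>x\<in>cantor n. g x \<noteq> x)"
proof (cases "g \<in> V_set n H")
  case True
  have one: "\<one>\<^bsub>V n H\<^esub> \<in> V_set n H"
    using group.is_monoid[OF group_V] monoid.one_closed carrier_V by metis
  have "g = \<one>\<^bsub>V n H\<^esub> \<longleftrightarrow> (\<forall>x\<in>cantor n. g x = x)"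
    using V_set_eqI[OF True one] V_one by auto
  moreover have "g [^]\<^bsub>V n H\<^esub> p = \<one>\<^bsub>V n H\<^esub> \<longleftrightarrow> (\<forall>x\<in>cantor n. (g ^^ p) x = x)"
    using V_set_eqI[OF V_pow(1)[OF True] one, of p] V_pow(2)[OF True, of _ p] V_one
    by (metis (no_types, lifting) restrict_apply')
  ultimately show ?thesis using True by (auto simp: has_prime_order_def carrier_V)
qed (simp add: has_prime_order_def carrier_V)

lemma conjugate_V_iff:
  assumes "g \<in> V_set n H" "g' \<in> V_set n H"
  shows "conjugate (V n H) g g' \<longleftrightarrow> (\<exists>h\<in>V_set n H. \<forall>x\<in>cantor n. h (g x) = g' (h x))"
proof -
  have "h \<otimes>\<^bsub>V n H\<^esub> g = g' \<otimes>\<^bsub>V n H\<^esub> h \<longleftrightarrow> (\<forall>x\<in>cantor n. h (g x) = g' (h x))"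
    if h: "h \<in> V_set n H" for h
    unfolding V_mult[OF h assms(1)] V_mult[OF assms(2) h] compose_def
    by (auto simp: restrict_def fun_eq_iff)
  then show ?thesis by (simp add: conjugate_def carrier_V)
qed

text \<open>A bijection of fundamental domains extends uniquely to an equivariant bijection of the free parts;
  together with a bijection of the fixed parts it conjugates one element to the other.\<close>

lemma conjugate_if_fundamental:
  assumes g: "g \<in> V_set n H" and g': "g' \<in> V_set n H" and p: "0 < p"
    and per: "\<And>x. x \<in> cantor n \<Longrightarrow> (g ^^ p) x = x" "\<And>x. x \<in> cantor n \<Longrightarrow> (g' ^^ p) x = x"
    and fund: "fundamental p g E D" "fundamental p g' E' D'"
    and op: "branch_open n E" "branch_open n D" "D \<subseteq> cantor n" "D' \<subseteq> cantor n"
    and k0: "bij_betw k0 E E'" "\<And>x. x \<in> E \<Longrightarrow> tame n H k0 x"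
    and k: "bij_betw k D D'" "\<And>x. x \<in> D \<Longrightarrow> tame n H k x"
  shows "conjugate (V n H) g g'"
proof -
  let ?\<Psi> = "\<lambda>(x, i). (g ^^ i) x" and ?\<Psi>' = "\<lambda>(x, i). (g' ^^ i) x"
  have E: "E \<subseteq> cantor n" "\<And>x. x \<in> E \<Longrightarrow> g x = x" and \<Psi>: "bij_betw ?\<Psi> (D \<times> {..<p}) (cantor n - E)"
    using fund(1) by (auto simp: fundamental_def)
  have E': "E' \<subseteq> cantor n" "\<And>x. x \<in> E' \<Longrightarrow> g' x = x" and \<Psi>': "bij_betw ?\<Psi>' (D' \<times> {..<p}) (cantor n - E')"
    using fund(2) by (auto simp: fundamental_def)
  define h1 where "h1 = ?\<Psi>' \<circ> map_prod k id \<circ> inv_into (D \<times> {..<p}) ?\<Psi>"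
  define h where "h x = (if x \<in> E then k0 x else h1 x)" for x
  have "bij_betw (map_prod k id) (D \<times> {..<p}) (D' \<times> {..<p})"
    using k(1) by (intro bij_betw_map_prod) (auto simp: bij_betw_def)
  then have h1: "bij_betw h1 (cantor n - E) (cantor n - E')"
    unfolding h1_def by (intro bij_betw_trans[OF bij_betw_inv_into[OF \<Psi>]] bij_betw_trans[OF _ \<Psi>'])
  have "bij_betw h E E'" using k0(1) by (rule bij_betw_cong[THEN iffD2, rotated]) (simp add: h_def)
  moreover have "bij_betw h (cantor n - E) (cantor n - E')"
    using h1 by (rule bij_betw_cong[THEN iffD2, rotated]) (simp add: h_def)
  ultimately have "bij_betw h (E \<union> (cantor n - E)) (E' \<union> (cantor n - E'))"
    by (rule bij_betw_combine) blast
  then have bij: "bij_betw h (cantor n) (cantor n)"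
    using E(1) E'(1) by (simp add: Un_absorb1)
  have orbit: "(g ^^ i) d \<in> cantor n - E \<and> h ((g ^^ i) d) = (g' ^^ i) (k d)" if d: "d \<in> D" for d i
  proof -
    have j: "(d, i mod p) \<in> D \<times> {..<p}" using d p by simp
    have mod: "(g ^^ (i mod p)) d = (g ^^ i) d"
      using d op(3) by (intro funpow_mod_eq per(1)) auto
    have mod': "(g' ^^ (i mod p)) (k d) = (g' ^^ i) (k d)"
      using d op(4) k(1) by (intro funpow_mod_eq per(2)) (auto dest: bij_betwE)
    have out: "(g ^^ i) d \<in> cantor n - E"
      using bij_betw_apply[OF \<Psi> j] mod by simp
    have "inv_into (D \<times> {..<p}) ?\<Psi> ((g ^^ i) d) = (d, i mod p)"
      using bij_betw_inv_into_left[OF \<Psi> j] mod by simp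
    then have "h1 ((g ^^ i) d) = (g' ^^ i) (k d)" by (simp add: h1_def mod')
    then show ?thesis using out by (simp add: h_def)
  qed
  have param: "\<exists>d i. d \<in> D \<and> i < p \<and> x = (g ^^ i) d" if "x \<in> cantor n - E" for x
  proof -
    have "x \<in> ?\<Psi> ` (D \<times> {..<p})" using bij_betw_imp_surj_on[OF \<Psi>] that by simp
    then show ?thesis by auto
  qed
  have "tame n H h x" if x: "x \<in> cantor n" for x
  proof (cases "x \<in> E")
    case True
    show ?thesis by (rule tame_cong[OF k0(2)[OF True] op(1) True]) (simp add: h_def)
  next
    case False
    then obtain d i where di: "d \<in> D" "i < p" "x = (g ^^ i) d" using param x by blast
    \<comment> \<open>Near x, first pull back along the orbit into D, then apply k, then push forward.\<close>
    define U where "U = {y \<in> cantor n. (g ^^ (p - i)) y \<in> D}"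
    have "branch_open n U"
      unfolding U_def by (rule branch_open_vimage[OF V_pow_tame[OF g] op(2)])
    moreover have pd: "(g ^^ (p - i)) x = d"
    proof -
      have "(g ^^ (p - i)) x = (g ^^ (p - i + i)) d" unfolding di(3) by (simp only: funpow_add o_apply)
      then show ?thesis using di op(3) per(1) by auto
    qed
    then have "x \<in> U" using x di(1) by (simp add: U_def)
    moreover have "tame n H (\<lambda>y. (g' ^^ i) (k ((g ^^ (p - i)) y))) x"
    proof -
      have "tame n H (\<lambda>y. k ((g ^^ (p - i)) y)) x"
        using tame_comp[OF V_pow_tame[OF g x, of "p - i"], of k] k(2) di(1) pd by simp
      moreover from tame_in_cantor(2)[OF this]
      have "tame n H (g' ^^ i) (k ((g ^^ (p - i)) x))" by (rule V_pow_tame[OF g'])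
      ultimately show ?thesis using tame_comp[of "\<lambda>y. k ((g ^^ (p - i)) y)" x "g' ^^ i"] by simp
    qed
    moreover have "h y = (g' ^^ i) (k ((g ^^ (p - i)) y))" if y: "y \<in> U" for y
    proof -
      have "(g ^^ i) ((g ^^ (p - i)) y) = (g ^^ (i + (p - i))) y" by (simp only: funpow_add o_apply)
      then have "y = (g ^^ i) ((g ^^ (p - i)) y)" using di(2) per(1) y by (simp add: U_def)
      then show ?thesis using orbit[of "(g ^^ (p - i)) y" i] y by (simp add: U_def)
    qed
    ultimately show ?thesis using tame_cong by blast
  qed
  then have hV: "restrict h (cantor n) \<in> V_set n H" by (rule V_setI[OF bij])
  have "h (g x) = g' (h x)" if x: "x \<in> cantor n" for x
  proof (cases "x \<in> E")
    case True
    then have "h x \<in> E'" using \<open>bij_betw h E E'\<close> by (rule bij_betw_apply[rotated])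
    then show ?thesis using E(2)[OF True] E'(2) by simp
  next
    case False
    then obtain d i where di: "d \<in> D" "i < p" "x = (g ^^ i) d" using param x by blast
    then show ?thesis using orbit[OF di(1), of i] orbit[OF di(1), of "Suc i"] by simp
  qed
  moreover have "g x \<in> cantor n" if "x \<in> cantor n" for x
    using bij_betw_apply[OF V_setD(1)[OF g] that] .
  ultimately show ?thesis
    unfolding conjugate_V_iff[OF g g'] by (intro bexI[OF _ hV]) simp
qed

text \<open>An element of order \<open>p\<close> is determined up to conjugacy by whether its fixed part is empty and by the size of its
  fundamental domain; the size of the fixed part follows since the whole space has size 1. An empty
  fixed part leaves a single size, as \<open>p\<close> is invertible modulo \<open>n - 1\<close>. This makes at most
  \<open>(n - 1) + 1\<close> classes.\<close>

lemma nonconjugate_family_card_le: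
  assumes p: "Factorial_Ring.prime p" "n < p" and K: "nonconjugate_family (V n H) p K"
  shows "card K \<le> n"
proof -
  have "\<exists>F T. code n F \<and> code n T \<and> T \<noteq> {} \<and> [card F + p * card T = 1] (mod (n - 1)) \<and>
    fundamental p g (region n F) (region n T)" if "g \<in> K" for g
  proof -
    have "has_prime_order (V n H) p g" using K that by (auto simp: nonconjugate_family_def)
    then obtain x where "g \<in> V_set n H" "\<And>x. x \<in> cantor n \<Longrightarrow> (g ^^ p) x = x" "x \<in> cantor n" "g x \<noteq> x"
      unfolding has_prime_order_V_iff by blast
    from torsion_structure[OF this(1) p this(2-4)] show ?thesis by metis
  qed
  then obtain F T where FT: "\<And>g. g \<in> K \<Longrightarrow> code n (F g) \<and> code n (T g) \<and> T g \<noteq> {} \<and>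
      [card (F g) + p * card (T g) = 1] (mod (n - 1)) \<and> fundamental p g (region n (F g)) (region n (T g))"
    by metis
  \<comment> \<open>The value n - 1, which is no residue, encodes an empty fixed part.\<close>
  define c where "c g = (if F g = {} then n - 1 else card (T g) mod (n - 1))" for g
  have pos: "0 < n - 1" using two_le by simp
  have "inj_on c K"
  proof (rule inj_onI)
    fix g g' assume gg: "g \<in> K" "g' \<in> K" "c g = c g'"
    have codes: "code n (F g)" "code n (T g)" "code n (F g')" "code n (T g')"
      and fund: "fundamental p g (region n (F g)) (region n (T g))"
        "fundamental p g' (region n (F g')) (region n (T g'))"
      using FT[OF gg(1)] FT[OF gg(2)] by simp_all
    have *: "[card (T g) = card (T g')] (mod (n - 1)) \<and> (F g = {} \<longleftrightarrow> F g' = {})"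
    proof (cases "F g = {} \<or> F g' = {}")
      case False
      then show ?thesis using gg(3) by (simp add: c_def cong_def)
    next
      case True
      have "card (T g) mod (n - 1) \<noteq> n - 1" "card (T g') mod (n - 1) \<noteq> n - 1"
        using pos by (metis mod_less_divisor less_irrefl)+
      then have emp: "F g = {}" "F g' = {}" using True gg(3) by (auto simp: c_def split: if_splits)
      then have "[p * card (T g) = 1] (mod (n - 1))" "[p * card (T g') = 1] (mod (n - 1))"
        using FT[OF gg(1)] FT[OF gg(2)] by auto
      then have "[p * card (T g) = p * card (T g')] (mod (n - 1))" by (metis cong_sym cong_trans)
      moreover have "coprime p (n - 1)"
        using p pos by (intro prime_imp_coprime) (auto dest: dvd_imp_le)
      ultimately show ?thesis using emp by (simp add: cong_mult_lcancel_nat)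
    qed
    have "[card (F g) + p * card (T g) = card (F g') + p * card (T g')] (mod (n - 1))"
      using FT[OF gg(1)] FT[OF gg(2)] by (metis cong_sym cong_trans)
    moreover have "[card (F g') + p * card (T g) = card (F g') + p * card (T g')] (mod (n - 1))"
      using * by (intro cong_add cong_mult) auto
    ultimately have "[card (F g) + p * card (T g) = card (F g') + p * card (T g)] (mod (n - 1))"
      by (metis cong_sym cong_trans)
    then have F: "[card (F g) = card (F g')] (mod (n - 1))" by (simp add: cong_add_rcancel_nat)
    obtain k0 where k0: "bij_betw k0 (region n (F g)) (region n (F g'))"
      "\<And>x. x \<in> region n (F g) \<Longrightarrow> tame n H k0 x"
      using regions_equivalent[OF codes(1,3) conjunct2[OF *] F] by metis
    have "T g = {} \<longleftrightarrow> T g' = {}" using FT[OF gg(1)] FT[OF gg(2)] by simp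
    then obtain k where k: "bij_betw k (region n (T g)) (region n (T g'))"
      "\<And>x. x \<in> region n (T g) \<Longrightarrow> tame n H k x"
      using regions_equivalent[OF codes(2,4) _ conjunct1[OF *]] by metis
    have g: "g \<in> V_set n H" "\<And>x. x \<in> cantor n \<Longrightarrow> (g ^^ p) x = x"
      and g': "g' \<in> V_set n H" "\<And>x. x \<in> cantor n \<Longrightarrow> (g' ^^ p) x = x"
      using K gg unfolding nonconjugate_family_def has_prime_order_V_iff by blast+
    have "conjugate (V n H) g g'"
      by (rule conjugate_if_fundamental[OF g(1) g'(1) prime_gt_0_nat[OF p(1)] g(2) g'(2) fund
            branch_open_region branch_open_region region_subset_cantor region_subset_cantor k0 k])
        (simp_all add: codes[THEN codeD(2)])
    then show "g = g'" using K gg by (auto simp: nonconjugate_family_def)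
  qed
  moreover have "c ` K \<subseteq> {..<n}"
  proof
    fix y assume "y \<in> c ` K"
    then obtain g where "y = c g" by blast
    moreover have "card (T g) mod (n - 1) < n"
      using mod_less_divisor[OF pos, of "card (T g)"] by linarith
    ultimately show "y \<in> {..<n}" using pos by (simp add: c_def)
  qed
  ultimately show ?thesis using card_inj_on_le[of c K "{..<n}"] by simp
qed

end

section \<open>Representatives of all classes\<close>

context label_group
begin

text \<open>Arrange the words of \<open>S\<close> in \<open>b\<close> cycles of length \<open>p\<close> and let the element permute their branches
  accordingly, by prefix replacement.\<close>

lemma torsion_with_support:
  assumes p: "Factorial_Ring.prime p" and A: "code n A" "region n A = cantor n"
    and S: "S \<subseteq> A" "S \<noteq> {}" "card S = p * b"
  obtains g where "has_prime_order (V n H) p g"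
    "\<And>x. x \<in> cantor n \<Longrightarrow> g x \<noteq> x \<longleftrightarrow> x \<in> region n S"
proof -
  note cA = codeD[OF A(1)]
  have p2: "2 \<le> p" using p by (rule prime_ge_2_nat)
  have "finite S" using S(1) cA(1) by (rule finite_subset)
  then obtain e where e: "bij_betw e ({..<b} \<times> {..<p}) S"
    using finite_same_card_bij[of "{..<b} \<times> {..<p}" S] S(3)
    by (auto simp: card_cartesian_product mult.commute)
  define \<pi> where "\<pi> u = (if u \<in> S then (case inv_into ({..<b} \<times> {..<p}) e u of
    (a, i) \<Rightarrow> e (a, Suc i mod p)) else u)" for u
  have eS: "e (a, i) \<in> S" if "a < b" "i < p" for a i
    using bij_betw_apply[OF e] that by simp
  have Se: "\<exists>a i. a < b \<and> i < p \<and> u = e (a, i)" if "u \<in> S" for u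
  proof -
    have "u \<in> e ` ({..<b} \<times> {..<p})" using bij_betw_imp_surj_on[OF e] that by simp
    then show ?thesis by auto
  qed
  have \<pi>_e: "\<pi> (e (a, i)) = e (a, Suc i mod p)" if "a < b" "i < p" for a i
    using bij_betw_inv_into_left[OF e, of "(a, i)"] eS[OF that] that by (simp add: \<pi>_def)
  have \<pi>_pow: "(\<pi> ^^ k) (e (a, i)) = e (a, (i + k) mod p)" if "a < b" "i < p" for a i k
    using that p2 by (induction k) (auto simp: \<pi>_e mod_Suc_eq)
  have \<pi>_S: "\<pi> u \<in> S \<and> \<pi> u \<noteq> u" if u: "u \<in> S" for u
  proof -
    obtain a i where ai: "a < b" "i < p" "u = e (a, i)" using Se[OF u] by blast
    have lt: "Suc i mod p < p" using p2 by simp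
    have "Suc i mod p \<noteq> i" using ai(2) p2 by (simp add: mod_Suc)
    then have "e (a, Suc i mod p) \<noteq> e (a, i)"
      using bij_betw_imp_inj_on[OF e] ai(1,2) lt by (auto dest: inj_onD)
    then show ?thesis using \<pi>_e eS ai lt by simp
  qed
  have \<pi>_out: "\<pi> u = u" if "u \<notin> S" for u using that by (simp add: \<pi>_def)
  have \<pi>_A: "\<pi> u \<in> A" if "u \<in> A" for u
    using that \<pi>_S \<pi>_out S(1) by (cases "u \<in> S") auto
  have \<pi>_pow_A: "(\<pi> ^^ k) u \<in> A" if "u \<in> A" for u k
    using that \<pi>_A by (induction k) auto
  have \<pi>_per: "(\<pi> ^^ p) u = u" for u
  proof (cases "u \<in> S")
    case True
    then show ?thesis using Se[OF True] \<pi>_pow by auto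
  next
    case False
    then have "(\<pi> ^^ k) u = u" for k using \<pi>_out by (induction k) auto
    then show ?thesis .
  qed
  have Suc_p: "Suc (p - 1) = p" using p2 by simp
  have "bij_betw \<pi> A A"
  proof (rule bij_betw_byWitness[where f' = "\<pi> ^^ (p - 1)"])
    show "\<forall>u\<in>A. (\<pi> ^^ (p - 1)) (\<pi> u) = u"
      using \<pi>_per Suc_p by (metis funpow_Suc_right o_apply)
    show "\<forall>u\<in>A. \<pi> ((\<pi> ^^ (p - 1)) u) = u"
      using \<pi>_per Suc_p by (metis funpow.simps(2) o_apply)
  qed (use \<pi>_A \<pi>_pow_A in auto)
  then obtain f where f: "bij_betw f (cantor n) (cantor n)"
    "\<And>u w. u \<in> A \<Longrightarrow> w \<in> cantor n \<Longrightarrow> f (u @- w) = \<pi> u @- w"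
    using word_bijection_map[OF A(1) A(1)] A(2) by metis
  define g where "g = restrict f (cantor n)"
  have tame_f: "tame n H f x" if "x \<in> cantor n" for x
    by (rule tame_word_map[OF cA(2) f(2)]) (use \<pi>_A cA(2) A(2) that in auto)
  have gV: "g \<in> V_set n H"
    unfolding g_def by (rule V_setI[OF f(1) tame_f])
  have g: "g (u @- w) = \<pi> u @- w" if "u \<in> A" "w \<in> cantor n" for u w
    using f(2)[OF that] shift_streams[of u "{1..n}" w] that cA(2) by (auto simp: g_def)
  have g_pow: "(g ^^ k) (u @- w) = (\<pi> ^^ k) u @- w" if "u \<in> A" "w \<in> cantor n" for u w k
    using g \<pi>_pow_A that by (induction k) auto
  have dec: "\<exists>u w. u \<in> A \<and> w \<in> cantor n \<and> x = u @- w" if "x \<in> cantor n" for x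
  proof -
    have "x \<in> region n A" using A(2) that by simp
    then show ?thesis unfolding region_def branch_def by blast
  qed
  have supp: "g x \<noteq> x \<longleftrightarrow> x \<in> region n S" if x: "x \<in> cantor n" for x
  proof -
    obtain u w where uw: "u \<in> A" "w \<in> cantor n" "x = u @- w" using dec[OF x] by blast
    have xu: "x \<in> branch n u" using shift_in_branch uw by simp
    have "x \<in> region n S \<longleftrightarrow> u \<in> S"
      using cA(3)[OF uw(1) _ xu] S(1) xu unfolding region_def by blast
    moreover have "g x = x \<longleftrightarrow> \<pi> u = u"
    proof
      assume "g x = x"
      then have "x \<in> branch n (\<pi> u)" using g[OF uw(1,2)] uw(2,3) shift_in_branch by metis
      then show "\<pi> u = u" using cA(3)[OF uw(1) \<pi>_A[OF uw(1)] xu] by simp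
    qed (use g uw in simp)
    ultimately show ?thesis using \<pi>_S \<pi>_out by blast
  qed
  have "(g ^^ p) x = x" if "x \<in> cantor n" for x
    using dec[OF that] g_pow \<pi>_per by auto
  moreover have "\<exists>x\<in>cantor n. g x \<noteq> x"
  proof -
    have "region n S \<noteq> {}" using region_empty_iff[of n S] S(2) two_le by simp
    moreover have "region n S \<subseteq> cantor n" using region_subset_cantor S(1) cA(2) by blast
    ultimately show ?thesis using supp by blast
  qed
  ultimately have "has_prime_order (V n H) p g"
    unfolding has_prime_order_V_iff using gV by blast
  then show ?thesis using that supp by blast
qed

lemma conjugate_moved_image:
  assumes h: "h \<in> V_set n H" and eq: "\<And>x. x \<in> cantor n \<Longrightarrow> h (g x) = g' (h x)"
    and g: "g \<in> V_set n H"
  shows "h ` {x \<in> cantor n. g x \<noteq> x} = {x \<in> cantor n. g' x \<noteq> x}"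
proof -
  note bij = V_setD(1)[OF h]
  have "h x \<in> cantor n \<and> (g' (h x) \<noteq> h x \<longleftrightarrow> g x \<noteq> x)" if x: "x \<in> cantor n" for x
  proof -
    have "g x \<in> cantor n" using bij_betw_apply[OF V_setD(1)[OF g] x] .
    then have "h (g x) = h x \<longleftrightarrow> g x = x"
      using bij_betw_imp_inj_on[OF bij] x by (auto dest: inj_onD)
    then show ?thesis using eq[OF x] bij_betw_apply[OF bij x] by simp
  qed
  moreover have "\<exists>x\<in>cantor n. y = h x" if "y \<in> cantor n" for y
    using bij_betw_imp_surj_on[OF bij] that by blast
  ultimately show ?thesis by blast
qed

text \<open>All classes allowed by the upper bound occur. The moved set of a conjugate is an image under the group,
  so its size, and whether it is the whole space, are invariants. Moved sets of size \<open>p * c\<close> other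
  than the whole space exist for each residue \<open>c\<close>, and these sizes differ since \<open>p\<close> is invertible modulo
  \<open>n - 1\<close>; one further element has no fixed point.\<close>

lemma nonconjugate_family_exists:
  assumes p: "Factorial_Ring.prime p" "n < p"
  obtains K where "nonconjugate_family (V n H) p K" "card K = n"
proof -
  have p0: "0 < p" using p(1) by (rule prime_gt_0_nat)
  have pos: "0 < n - 1" using two_le by simp
  have cop: "coprime p (n - 1)"
    using p pos by (intro prime_imp_coprime) (auto dest: dvd_imp_le)
  define realises where "realises c g S \<longleftrightarrow> has_prime_order (V n H) p g \<and> code n S \<and>
      {x \<in> cantor n. g x \<noteq> x} = region n S \<and>
      (c < n - 1 \<longrightarrow> region n S \<noteq> cantor n \<and> [card S = p * c] (mod (n - 1))) \<and>
      (c = n - 1 \<longrightarrow> region n S = cantor n)" for c g S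
  have "\<exists>g S. realises c g S" for c
  proof -
    have "\<exists>A S b. code n A \<and> region n A = cantor n \<and> S \<subseteq> A \<and> card S = p * b \<and> 0 < b \<and>
      (c < n - 1 \<longrightarrow> region n S \<noteq> cantor n \<and> [card S = p * c] (mod (n - 1))) \<and>
      (c = n - 1 \<longrightarrow> region n S = cantor n)"
    proof (cases "c = n - 1")
      case True
      obtain b0 where b0: "[p * b0 = 1] (mod (n - 1))"
        using cong_solve_coprime_nat[OF cop] by (auto simp: One_nat_def)
      \<comment> \<open>Adding n - 1 keeps the residue and makes b positive even if b0 = 0.\<close>
      define b where "b = b0 + (n - 1)"
      have b: "0 < b" using pos by (simp add: b_def)
      have "[p * b = p * b0] (mod (n - 1))" by (simp add: b_def cong_def distrib_left)
      then have "[p * b = 1] (mod (n - 1))" using b0 by (rule cong_trans)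
      then obtain k where k: "p * b = 1 + k * (n - 1)" using p0 b by (auto simp: cong_to_1'_nat)
      obtain A where A: "code n A" "region n A = region n {[]}" "card A = card {[] :: nat list} + k * (n - 1)"
        using expand_code[OF code_Nil, of k] by blast
      have "card A = p * b" using A(3) k by simp
      then show ?thesis
        using A(1,2) True b by (intro exI[of _ A] exI[of _ A] exI[of _ b]) (simp add: region_Nil)
    next
      case False
      define b where "b = c + (n - 1)"
      have b: "0 < b" using pos by (simp add: b_def)
      obtain A where A: "code n A" "region n A = region n {[]}" "card A = card {[] :: nat list} + (p * b) * (n - 1)"
        using expand_code[OF code_Nil, of "p * b"] by blast
      have "p * b \<le> (p * b) * (n - 1)"
      proof -
        have "1 \<le> n - 1" using pos by linarith
        from mult_le_mono2[OF this, of "p * b"] show ?thesis by simp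
      qed
      moreover have "card A = 1 + (p * b) * (n - 1)" using A(3) by simp
      ultimately have less: "p * b < card A" by linarith
      then obtain S where S: "S \<subseteq> A" "card S = p * b"
        using obtain_subset_with_card_n[of "p * b" A] by (metis less_imp_le)
      have "region n S \<noteq> cantor n"
      proof -
        obtain u where u: "u \<in> A" "u \<notin> S" using S less by (metis nat_less_le subsetI subset_antisym)
        have "region n {u} \<inter> region n S = {}" using region_inter[OF A(1), of "{u}" S] u S(1) by simp
        moreover have "region n {u} \<noteq> {}" using region_empty_iff[of n "{u}"] two_le by simp
        moreover have "region n {u} \<subseteq> cantor n" using region_subset_cantor codeD(2)[OF A(1)] u(1) by blast
        ultimately show ?thesis by blast
      qed
      moreover have "[card S = p * c] (mod (n - 1))" by (simp add: S(2) b_def cong_def distrib_left)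
      ultimately show ?thesis
        using A(1,2) S b False region_Nil by (intro exI[of _ A] exI[of _ S] exI[of _ b]) simp
    qed
    then obtain A S b where *: "code n A" "region n A = cantor n" "S \<subseteq> A" "card S = p * b" "0 < b"
      "(c < n - 1 \<longrightarrow> region n S \<noteq> cantor n \<and> [card S = p * c] (mod (n - 1))) \<and>
      (c = n - 1 \<longrightarrow> region n S = cantor n)" by blast
    have "S \<noteq> {}" using *(4,5) p0 by auto
    then obtain g where g: "has_prime_order (V n H) p g"
      "\<And>x. x \<in> cantor n \<Longrightarrow> g x \<noteq> x \<longleftrightarrow> x \<in> region n S"
      using torsion_with_support[OF p(1) *(1-3) _ *(4)] by blast
    have S: "code n S" using code_subset *(1,3) by blast
    then have "{x \<in> cantor n. g x \<noteq> x} = region n S"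
      using g(2) region_subset_cantor[OF codeD(2)[OF S]] by blast
    then show ?thesis using g(1) S *(6) unfolding realises_def by blast
  qed
  then obtain G S where "\<And>c. realises c (G c) (S c)" by metis
  then have GS: "\<And>c. has_prime_order (V n H) p (G c)" "\<And>c. code n (S c)"
    "\<And>c. {x \<in> cantor n. G c x \<noteq> x} = region n (S c)"
    "\<And>c. c < n - 1 \<Longrightarrow> region n (S c) \<noteq> cantor n"
    "\<And>c. c < n - 1 \<Longrightarrow> [card (S c) = p * c] (mod (n - 1))"
    "region n (S (n - 1)) = cantor n"
    by (simp_all add: realises_def)
  have GV: "G c \<in> V_set n H" for c using GS(1) has_prime_order_V_iff by blast
  have distinct: "c = c'" if conj: "conjugate (V n H) (G c) (G c')" and c: "c < n" "c' < n" for c c'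
  proof -
    obtain h where h: "h \<in> V_set n H" "\<And>x. x \<in> cantor n \<Longrightarrow> h (G c x) = G c' (h x)"
      using conj unfolding conjugate_V_iff[OF GV GV] by blast
    have img: "h ` region n (S c) = region n (S c')"
      using conjugate_moved_image[OF h GV] unfolding GS(3) .
    have bij: "bij_betw h (cantor n) (cantor n)" by (rule V_setD(1)[OF h(1)])
    have "region n (S c) = cantor n \<longleftrightarrow> region n (S c') = cantor n"
    proof
      assume "region n (S c) = cantor n"
      then show "region n (S c') = cantor n" using img bij_betw_imp_surj_on[OF bij] by simp
    next
      assume "region n (S c') = cantor n"
      then have "h ` region n (S c) = h ` cantor n" using img bij_betw_imp_surj_on[OF bij] by simp
      moreover have "region n (S c) \<subseteq> cantor n" using GS(3)[of c] by blast
      ultimately show "region n (S c) = cantor n"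
        using inj_on_image_eq_iff[OF bij_betw_imp_inj_on[OF bij]] by blast
    qed
    moreover have full: "region n (S d) = cantor n \<longleftrightarrow> d = n - 1" if "d < n" for d
    proof (cases "d = n - 1")
      case False
      then have "d < n - 1" using that by simp
      then show ?thesis using GS(4) False by blast
    qed (use GS(6) in simp)
    ultimately have eq_last: "c = n - 1 \<longleftrightarrow> c' = n - 1" using c by simp
    show ?thesis
    proof (cases "c = n - 1")
      case True
      then show ?thesis using eq_last by simp
    next
      case False
      then have less: "c < n - 1" "c' < n - 1" using eq_last c by auto
      have "[card (S c) = card (S c')] (mod (n - 1))"
        by (rule tame_image_card[OF bij_betw_imp_inj_on[OF bij] V_setD(2)[OF h(1)] GS(2) GS(2) img])
      then have "[p * c = p * c'] (mod (n - 1))"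
        using GS(5)[OF less(1)] GS(5)[OF less(2)] by (metis cong_sym cong_trans)
      then have "[c = c'] (mod (n - 1))" using cop by (simp add: cong_mult_lcancel_nat)
      then show ?thesis using less by (rule cong_less_modulus_unique_nat)
    qed
  qed
  have one: "h \<in> V_set n H \<Longrightarrow> conjugate (V n H) h h" for h
    unfolding conjugate_V_iff by blast
  have "inj_on G {..<n}"
    using distinct one[OF GV] by (intro inj_onI) (metis lessThan_iff)
  then have "card (G ` {..<n}) = n" by (simp add: card_image)
  moreover have "nonconjugate_family (V n H) p (G ` {..<n})"
    unfolding nonconjugate_family_def using GS(1) distinct by blast
  ultimately show ?thesis using that by blast
qed

end

section \<open>Comparing two alphabets\<close>

text \<open>A prime above both alphabet sizes makes the class count available in both groups.\<close>

lemma alphabet_size_le_if_iso: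
  assumes "label_group n P" "label_group m Q" "V m Q \<cong> V n P"
  shows "m \<le> n"
proof -
  obtain p where p: "Factorial_Ring.prime p" "max n m < p" using bigger_prime by blast
  obtain K where K: "nonconjugate_family (V m Q) p K" "card K = m"
    using label_group.nonconjugate_family_exists[OF assms(2) p(1)] p(2) by auto
  obtain \<phi> where "\<phi> \<in> iso (V m Q) (V n P)" using assms(3) by (auto simp: is_iso_def)
  note \<phi> = iso_nonconjugate_family[OF label_group.group_V[OF assms(2)] label_group.group_V[OF assms(1)] this K(1)]
  show ?thesis
    using label_group.nonconjugate_family_card_le[OF assms(1) p(1) _ \<phi>(1)] \<phi>(2) K(2) p(2) by simp
qed

theorem theorem1p2:
  fixes n m :: nat and P Q :: "(nat \<Rightarrow> nat) set"
  assumes "n \<ge> 2" and "m \<ge> 2" and "n \<noteq> m"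
    and "subgroup P (sym_group n)" and "subgroup Q (sym_group m)"
  shows "\<not> V n P \<cong> V m Q"
proof
  assume iso: "V n P \<cong> V m Q"
  have L: "label_group n P" "label_group m Q"
    using assms by (simp_all add: label_group_def label_group_axioms_def alphabet_def)
  have "V m Q \<cong> V n P" using group.iso_sym[OF label_group.group_V[OF L(1)] iso] .
  then show False
    using alphabet_size_le_if_iso[OF L] alphabet_size_le_if_iso[OF L(2,1) iso] assms(3) by simp
qed

end
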